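(* Let $\eta$ be a point process (random element) in $M_p(\mathcal{R}_0^d)$ such that, for some $k\in\{2,\dots,d\}$, $$\big(\eta,d(0,\eta)\big)\in\mathrm{RV}\big(M_p(\mathcal{R}_0^d)\times[0,\infty],\,\cdot\,,\mathcal{M}_p^{(k)}(\mathcal{R}_0^d)\times[0,\infty],\,g,\,\mu^*\big).$$ Then $\mathrm{cl}(\mathrm{supp}\,\eta)\in\mathrm{RV}(\mathcal{K}^d,\cdot,\mathfrak{K}_{[k-1]},g,\tilde\mu)$, and the tail measure $\tilde\mu$ is the pushforward of $\mu^*$ under the map $\psi$ defined in the context.
   Context: An ideal $\mathcal{S}$ on a space $E$ is a family of subsets closed under finite unions and under taking subsets; $U_{\mathcal{S}}$ is the union of all its members. For a metrisable space $E$ with scaling $(T_t)_{t>0}$, an ideal $\mathcal{S}$, and a random element $\xi$ in $E$, $\xi\in\mathrm{RV}(E,T,\mathcal{S},g,\mu)$ means: $g:[0,\infty)\to[0,\infty)$ is measurable with $g(t)\to\infty$ as $t\to\infty$; $\mu$ (the tail measure) is a Borel measure finite on Borel sets in $\mathcal{S}$, vanishing outside $U_{\mathcal{S}}$, and non-trivial, i.e. $\mu(B)>0$ for some $B\in\mathcal{S}$; and $g(t)\mathbf{E}f(T_{t^{-1}}\xi)\to\int f\,d\mu$ as $t\to\infty$ for all bounded continuous $f:U_{\mathcal{S}}\to\mathbb{R}$ with support (closure in $E$ of $\{f\ne0\}$) in $\mathcal{S}$ (with $f$ set to $0$ outside $U_{\mathcal{S}}$). Pushforwards of tail measures are considered on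 sets of the target ideal (restricted to its union). Linear scaling is denoted by $\cdot$. $\mathcal{R}_0^d=\{A\subset\mathbb{R}^d:\inf_{x\in A}\|x\|>0\}$, where $\|\cdot\|$ is the Euclidean norm. $M_p(\mathcal{R}_0^d)$ is the set of counting (non-negative integer-valued) Borel measures $m$ on $\mathbb{R}^d\setminus\{0\}$ which are finite on Borel sets from $\mathcal{R}_0^d$, with the vague topology (generated by $m\mapsto\int f\,dm$ for bounded continuous $f$ with support in $\mathcal{R}_0^d$) and the scaling $(T_tm)(A)=m(t^{-1}A)$ (linear scaling applied to the atoms). $\mathcal{M}_p^{(k)}(\mathcal{R}_0^d)$ is the ideal of all $D\subset M_p(\mathcal{R}_0^d)$ for which there is a Borel $A\in\mathcal{R}_0^d$ with $m(A)\ge k$ for all $m\in D$. The product space $M_p(\mathcal{R}_0^d)\times[0,\infty]$ has the product topology, the scaling $T_t(m,r)=(T_tm,tr)$ (with $t\infty=\infty$), and the ideal $\mathcal{M}_p^{(k)}(\mathcal{R}_0^d)\times[0,\infty]$ generated by the sets $D\times[0,\infty]$, $D\in\mathcal{M}_p^{(k)}(\mathcal{R}_0^d)$. $\mathrm{supp}\,m$ is the set of atoms of $m$, and $\mathrm{cl}$ denotes closure in $\mathbb{R}^d$; $d(0,m)=\inf\{\|x\|:x\in\mathrm{supp}\,m\}$, with $d(0,m)=\infty$ if $m=0$. Let $M'=\{(m,r)\in M_p(\mathcal{R}_0^d)\times[0,\infty): r=d(0,m)\text{ or }r=0\}\cup\{(0,\infty)\}$. The map $\psi:M'\to\mathcal{K}^d$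 is given by $\psi(m,r)=\mathrm{cl}(\mathrm{supp}\,m)$ if $m\neq0$, $r>0$; $\psi(m,0)=\mathrm{cl}(\mathrm{supp}\,m)\cup\{0\}$ if $m\ne0$; $\psi(0,0)=\{0\}$; $\psi(0,\infty)=\emptyset$. (The set $M'$ is closed and $\mu^*$ is supported on $M'$.) $\mathcal{K}^d$ is the family of compact subsets of $\mathbb{R}^d$ with the Hausdorff metric $d_H$ (the distance from a non-empty set to $\emptyset$ being infinite) and linear scaling $T_tK=tK$. For $j\in\{0,\dots,d-1\}$, $\mathfrak{K}_{[j]}$ is the ideal of all families $\mathcal{A}\subset\mathcal{K}^d$ with $\inf_{K\in\mathcal{A}}\tau_{[j]}(K)>0$, where $\tau_{[j]}(K)=\inf_{H\in G(d,j)}\inf_{L\in\mathcal{K}^d,L\subset H}d_H(K,L)$ and $G(d,j)$ is the family of all $j$-dimensional linear subspaces of $\mathbb{R}^d$; equivalently $\tau_{[j]}(K)=\inf_{H\in G(d,j)}\inf\{\varepsilon>0:K\subset H+B_\varepsilon(0)\}$, where $B_\varepsilon(0)$ is the closed ball of radius $\varepsilon$ centred at the origin.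
   Formalization: Non-triviality of the tail measure is not claimed: it can fail (e.g. all atoms of η on one line, d=k=2). All other requirements of RV are proved for the pushforward of μ* under ψ, and full RV whenever this pushforward is non-trivial on 𝔎_[k-1]. *)

theory Defs
  imports "HOL-Probability.Probability"
begin

section \<open>Ideals, scalings and regular variation\<close>

definition ideal_on :: "'a set \<Rightarrow> 'a set set \<Rightarrow> bool" where
  "ideal_on E I \<longleftrightarrow> I \<subseteq> Pow E \<and> {} \<in> I \<and> (\<forall>A\<in>I. \<forall>B\<in>I. A \<union> B \<in> I) \<and> (\<forall>A\<in>I. \<forall>B. B \<subseteq> A \<longrightarrow> B \<in> I)"

definition borel_of :: "'a topology \<Rightarrow> 'a measure" where
  "borel_of X = sigma (topspace X) {U. openin X U}"

definition scaling_on :: "'a topology \<Rightarrow> (real \<Rightarrow> 'a \<Rightarrow> 'a) \<Rightarrow> bool" where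
  "scaling_on X T \<longleftrightarrow>
     (\<forall>t>0. continuous_map X X (T t)) \<and>
     (\<forall>x\<in>topspace X. T 1 x = x) \<and>
     (\<forall>s>0. \<forall>t>0. \<forall>x\<in>topspace X. T s (T t x) = T (s * t) x)"

text \<open>
  The bounded continuous functions on the union of the ideal, with support in the ideal.
  They are represented by their extension by zero, which need not be continuous on the whole space.
\<close>
definition test_functions :: "'a topology \<Rightarrow> 'a set set \<Rightarrow> ('a \<Rightarrow> real) set" where
  "test_functions X I =
     {f. continuous_map (subtopology X (\<Union>I)) euclideanreal f \<and> (\<forall>x. x \<notin> \<Union>I \<longrightarrow> f x = 0) \<and>
         bounded (range f) \<and> X closure_of {x. f x \<noteq> 0} \<in> I}"

definition nontrivial_on :: "'a topology \<Rightarrow> 'a set set \<Rightarrow> 'a measure \<Rightarrow> bool" where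
  "nontrivial_on X I \<mu> \<longleftrightarrow> (\<exists>B\<in>sets (borel_of X). B \<in> I \<and> emeasure \<mu> B > 0)"

text \<open>
  All requirements of regular variation apart from the non-triviality of the tail measure.
\<close>
definition tail_limit ::
  "'w measure \<Rightarrow> 'a topology \<Rightarrow> (real \<Rightarrow> 'a \<Rightarrow> 'a) \<Rightarrow> 'a set set \<Rightarrow> (real \<Rightarrow> real) \<Rightarrow> 'a measure \<Rightarrow>
   ('w \<Rightarrow> 'a) \<Rightarrow> bool" where
  "tail_limit P X T I g \<mu> \<xi> \<longleftrightarrow>
     metrizable_space X \<and> scaling_on X T \<and> ideal_on (topspace X) I \<and>
     prob_space P \<and> \<xi> \<in> P \<rightarrow>\<^sub>M borel_of X \<and>
     g \<in> borel_measurable (restrict_space borel {0..}) \<and> (\<forall>t\<ge>0. g t \<ge> 0) \<and>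
     filterlim g at_top at_top \<and>
     sets \<mu> = sets (borel_of X) \<and>
     (\<forall>B\<in>sets \<mu>. B \<in> I \<longrightarrow> emeasure \<mu> B < \<infinity>) \<and>
     (\<forall>B\<in>sets \<mu>. B \<inter> \<Union>I = {} \<longrightarrow> emeasure \<mu> B = 0) \<and>
     (\<forall>f\<in>test_functions X I.
        ((\<lambda>t. g t * (\<integral>\<omega>. f (T (inverse t) (\<xi> \<omega>)) \<partial>P)) \<longlongrightarrow> (\<integral>x. f x \<partial>\<mu>)) at_top)"

definition regularly_varying ::
  "'w measure \<Rightarrow> 'a topology \<Rightarrow> (real \<Rightarrow> 'a \<Rightarrow> 'a) \<Rightarrow> 'a set set \<Rightarrow> (real \<Rightarrow> real) \<Rightarrow> 'a measure \<Rightarrow>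
   ('w \<Rightarrow> 'a) \<Rightarrow> bool" where
  "regularly_varying P X T I g \<mu> \<xi> \<longleftrightarrow> tail_limit P X T I g \<mu> \<xi> \<and> nontrivial_on X I \<mu>"

text \<open>
  Push-forward of \<open>\<mu>\<close> under a map \<open>h\<close> defined on \<open>S\<close>, restricted to the union of the target ideal
  and regarded as a Borel measure on \<open>Y\<close> vanishing outside that union.
\<close>
definition tail_pushforward ::
  "'a measure \<Rightarrow> 'a set \<Rightarrow> ('a \<Rightarrow> 'b) \<Rightarrow> 'b topology \<Rightarrow> 'b set set \<Rightarrow> 'b measure" where
  "tail_pushforward \<mu> S h Y J =
     density (distr (restrict_space \<mu> S) (borel_of Y) h) (indicator (\<Union>J))"

section \<open>Counting measures on the punctured space\<close>

text \<open>The infimum is taken in \<open>[0,\<infinity>]\<close>, so the empty set belongs to the ideal.\<close>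
definition away_from_zero :: "'a::euclidean_space set set" where
  "away_from_zero = {A. (INF x\<in>A. ennreal (norm x)) > 0}"

definition punctured :: "'a::euclidean_space measure" where
  "punctured = restrict_space borel (- {0})"

definition counting_measures :: "'a::euclidean_space measure set" where
  "counting_measures =
     {m. space m = space punctured \<and> sets m = sets punctured \<and>
         (\<forall>A\<in>sets m. \<exists>n. emeasure m A = ennreal_of_enat n) \<and>
         (\<forall>A\<in>sets borel. A \<in> away_from_zero \<longrightarrow> emeasure m A < \<infinity>)}"

definition vague_topology :: "'a::euclidean_space measure topology" where
  "vague_topology = topology_generated_by
     {{m \<in> counting_measures. (\<integral>x. f x \<partial>m) \<in> U} | f U.
        f \<in> test_functions euclidean away_from_zero \<and> open U}"

definition scale_measure_by :: "real \<Rightarrow> 'a::euclidean_space measure \<Rightarrow> 'a measure" where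
  "scale_measure_by t m = distr m punctured (\<lambda>x. t *\<^sub>R x)"

definition counting_ideal :: "nat \<Rightarrow> 'a::euclidean_space measure set set" where
  "counting_ideal k =
     {D. D \<subseteq> counting_measures \<and>
         (\<exists>A\<in>sets borel. A \<in> away_from_zero \<and> (\<forall>m\<in>D. emeasure m A \<ge> of_nat k))}"

definition atoms :: "'a::euclidean_space measure \<Rightarrow> 'a set" where
  "atoms m = {x. emeasure m {x} > 0}"

definition dist_zero :: "'a::euclidean_space measure \<Rightarrow> ennreal" where
  "dist_zero m = (INF x\<in>atoms m. ennreal (norm x))"

abbreviation marked_topology :: "('a::euclidean_space measure \<times> ennreal) topology" where
  "marked_topology \<equiv> prod_topology vague_topology euclidean"

definition marked_scaling ::
  "real \<Rightarrow> 'a::euclidean_space measure \<times> ennreal \<Rightarrow> 'a measure \<times> ennreal" where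
  "marked_scaling t = map_prod (scale_measure_by t) (\<lambda>r. ennreal t * r)"

definition marked_ideal :: "nat \<Rightarrow> ('a::euclidean_space measure \<times> ennreal) set set" where
  "marked_ideal k =
     ideal_on (topspace marked_topology) hull {D \<times> UNIV | D. D \<in> counting_ideal k}"

section \<open>Compact sets\<close>

text \<open>
  Extended Hausdorff distance: the distance from a non-empty set to the empty set is \<open>Inf {} = \<infinity>\<close>.
\<close>
definition hausdorff_dist :: "'a::euclidean_space set \<Rightarrow> 'a set \<Rightarrow> ennreal" where
  "hausdorff_dist K L =
     Inf {ennreal \<epsilon> | \<epsilon>. \<epsilon> > 0 \<and> K \<subseteq> (\<Union>x\<in>L. cball x \<epsilon>) \<and> L \<subseteq> (\<Union>x\<in>K. cball x \<epsilon>)}"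

definition hausdorff_topology :: "'a::euclidean_space set topology" where
  "hausdorff_topology = topology_generated_by
     {{L. compact L \<and> hausdorff_dist K L < ennreal \<epsilon>} | K \<epsilon>. compact K \<and> \<epsilon> > 0}"

definition set_scaling :: "real \<Rightarrow> 'a::euclidean_space set \<Rightarrow> 'a set" where
  "set_scaling t K = (\<lambda>x. t *\<^sub>R x) ` K"

definition subspace_dist :: "nat \<Rightarrow> 'a::euclidean_space set \<Rightarrow> ennreal" where
  "subspace_dist j K =
     (INF H\<in>{H. subspace H \<and> dim H = j}. INF L\<in>{L. compact L \<and> L \<subseteq> H}. hausdorff_dist K L)"

definition subspace_ideal :: "nat \<Rightarrow> 'a::euclidean_space set set set" where
  "subspace_ideal j = {A. A \<subseteq> Collect compact \<and> (INF K\<in>A. subspace_dist j K) > 0}"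

section \<open>The support map\<close>

definition support_domain :: "('a::euclidean_space measure \<times> ennreal) set" where
  "support_domain =
     {(m, r). m \<in> counting_measures \<and> r < \<infinity> \<and> (r = dist_zero m \<or> r = 0)} \<union>
     {(null_measure punctured, \<infinity>)}"

text \<open>Only the values on \<open>support_domain\<close> matter.\<close>
definition support_map :: "'a::euclidean_space measure \<times> ennreal \<Rightarrow> 'a set" where
  "support_map = (\<lambda>(m, r).
     if m \<noteq> null_measure punctured
     then (if r > 0 then closure (atoms m) else closure (atoms m) \<union> {0})
     else (if r = 0 then {0} else {}))"

end

theory Submission
  imports Defs
begin

text \<open>
  The statement is an instance of a mapping theorem for regular variation, applied to the map \<open>\<psi>\<close>
  that sends a counting measure \<open>m\<close> with a mark \<open>r\<close> to the closure of its atoms, with the origin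
  added when \<open>r = 0\<close>.

  Marking by the distance \<open>d(0, m)\<close> is what makes \<open>\<psi>\<close> continuous. Vague convergence controls the atoms
  outside every ball around the origin, including those near infinity, but it does not see atoms that
  shrink to the origin and disappear from the limiting measure; the Hausdorff limit of the supports then
  contains the origin. On \<open>M'\<close>, the set of pairs whose mark is \<open>d(0, m)\<close> or \<open>0\<close>, the limit of the marks records exactly
  whether this happens: a positive limit keeps all atoms away from the origin, and a limit
  \<open>0\<close> puts the origin into the limit set (\<open>continuous_map_support_map\<close>). The set \<open>M'\<close> is closed as well
  (\<open>closedin_support_domain\<close>). Both facts rest on the atoms of an integer-valued measure:
  it is carried by them, each of them has mass at least \<open>1\<close>, and only finitely many lie outside a ball around the origin
  (\<open>counting_measure_null_without_atoms\<close>, \<open>vague_limit_atom_near\<close>, \<open>vague_limit_no_atoms\<close>).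

  The ideals match because \<open>k - 1\<close> points always lie in a \<open>(k - 1)\<close>-dimensional subspace: if \<open>\<psi>(m, r)\<close> has
  distance at least \<open>c\<close> from all sets in such subspaces, then \<open>m\<close> has at least \<open>k\<close> atoms outside the ball of
  radius \<open>c/2\<close> (\<open>many_large_atoms\<close>).

  In the mapping theorem (\<open>tail_limit_pushforward\<close>) the map is only defined on a closed set \<open>S\<close> which
  contains the scaled random elements. A test function \<open>f\<close> on the target gives \<open>f \<circ> \<psi>\<close> on \<open>S\<close>, which
  extends to a test function on the whole source by Tietze's theorem and a cut-off. The
  integrals of the two test functions have the same limit, and this is the integral of \<open>f\<close> against the
  push-forward because the tail measure, like the scaled random elements, lives on \<open>S\<close> wherever test
  functions can see it (\<open>tail_measure_concentrated\<close>).
\<close>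

section \<open>Borel sets, limits and test functions on a topological space\<close>

lemma space_borel_of [simp]: "space (borel_of X) = topspace X"
  unfolding borel_of_def by (rule space_measure_of) (auto dest: openin_subset)

lemma sets_borel_of: "sets (borel_of X) = sigma_sets (topspace X) {U. openin X U}"
  unfolding borel_of_def by (rule sets_measure_of) (auto dest: openin_subset)

lemma openin_sets_borel_of: "openin X U \<Longrightarrow> U \<in> sets (borel_of X)"
  by (auto simp: sets_borel_of)

lemma closedin_sets_borel_of: "closedin X C \<Longrightarrow> C \<in> sets (borel_of X)"
proof -
  assume C: "closedin X C"
  then have "space (borel_of X) - (topspace X - C) \<in> sets (borel_of X)"
    by (intro sets.compl_sets openin_sets_borel_of) auto
  moreover have "space (borel_of X) - (topspace X - C) = C"
    using closedin_subset[OF C] by auto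
  ultimately show ?thesis by simp
qed

lemma measurable_borel_ofI:
  assumes "f \<in> space M \<rightarrow> topspace Y"
    and "\<And>V. openin Y V \<Longrightarrow> f -` V \<inter> space M \<in> sets M"
  shows "f \<in> M \<rightarrow>\<^sub>M borel_of Y"
  unfolding borel_of_def
  by (rule measurable_measure_of) (use assms in \<open>auto dest: openin_subset\<close>)

lemma continuous_map_measurable_restrict:
  assumes f: "continuous_map (subtopology X S) Y f" and S: "S \<in> sets (borel_of X)"
  shows "f \<in> restrict_space (borel_of X) S \<rightarrow>\<^sub>M borel_of Y"
proof (rule measurable_borel_ofI)
  have sub: "S \<subseteq> topspace X" using sets.sets_into_space[OF S] by simp
  show "f \<in> space (restrict_space (borel_of X) S) \<rightarrow> topspace Y"
    using continuous_map_funspace[OF f] sub by (auto simp: space_restrict_space)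
  fix V assume "openin Y V"
  from openin_continuous_map_preimage[OF f this] obtain U where
    U: "openin X U" and eq: "{x \<in> topspace (subtopology X S). f x \<in> V} = U \<inter> S"
    unfolding openin_subtopology by blast
  have "f -` V \<inter> space (restrict_space (borel_of X) S) = S \<inter> U"
    using eq sub by (auto simp: space_restrict_space)
  moreover have "S \<inter> U \<in> sets (restrict_space (borel_of X) S)"
    using U by (auto simp: sets_restrict_space intro: openin_sets_borel_of)
  ultimately show "f -` V \<inter> space (restrict_space (borel_of X) S) \<in> sets (restrict_space (borel_of X) S)"
    by simp
qed

lemma continuous_map_borel_measurable:
  fixes f :: "'a \<Rightarrow> 'b::topological_space"
  assumes f: "continuous_map X euclidean f"
  shows "f \<in> borel_measurable (borel_of X)"
proof (rule borel_measurableI)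
  fix S :: "'b set" assume "open S"
  then have "openin X {x \<in> topspace X. f x \<in> S}"
    using openin_continuous_map_preimage[OF f, of S] by simp
  moreover have "f -` S \<inter> space (borel_of X) = {x \<in> topspace X. f x \<in> S}" by auto
  ultimately show "f -` S \<inter> space (borel_of X) \<in> sets (borel_of X)"
    by (simp add: openin_sets_borel_of)
qed

lemma openin_iff_eventually_nhdsin:
  assumes "U \<subseteq> topspace X"
  shows "openin X U \<longleftrightarrow> (\<forall>x\<in>U. \<forall>\<^sub>F y in nhdsin X x. y \<in> U)"
proof -
  have "openin X U \<longleftrightarrow> (\<forall>x\<in>U. \<exists>T. openin X T \<and> x \<in> T \<and> T \<subseteq> U)"
    by (rule openin_subopen)
  also have "\<dots> \<longleftrightarrow> (\<forall>x\<in>U. \<forall>\<^sub>F y in nhdsin X x. y \<in> U)"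
    using assms by (intro ball_cong refl) (auto simp: eventually_nhdsin subset_iff)
  finally show ?thesis .
qed

lemma continuous_map_imp_tendsto_nhdsin:
  assumes "continuous_map X euclidean f" and "x \<in> topspace X"
  shows "(f \<longlongrightarrow> f x) (nhdsin X x)"
proof (rule topological_tendstoI)
  fix S assume "open S" "f x \<in> S"
  then have "openin X {y \<in> topspace X. f y \<in> S}"
    using openin_continuous_map_preimage[OF assms(1), of S] by simp
  with \<open>f x \<in> S\<close> assms(2) show "\<forall>\<^sub>F y in nhdsin X x. f y \<in> S"
    unfolding eventually_nhdsin by blast
qed

lemma eventually_nhdsin_subtopology:
  assumes "S \<subseteq> topspace X"
  shows "\<forall>\<^sub>F y in nhdsin (subtopology X S) x. y \<in> S"
proof -
  have "openin (subtopology X S) S"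
    by (metis assms inf.absorb_iff2 openin_subtopology_refl topspace_subtopology)
  then show ?thesis
    unfolding eventually_nhdsin using assms by (auto simp: inf_absorb2)
qed

text \<open>
  Where the union of the ideal is open, it and the complement of the closed support form an open cover,
  and on the latter the extension by zero vanishes.
\<close>
lemma test_functions_continuous:
  assumes I: "ideal_on (topspace X) I" and op: "openin X (\<Union>I)" and f: "f \<in> test_functions X I"
  shows "continuous_map X euclideanreal f"
proof -
  let ?C = "X closure_of {x. f x \<noteq> 0}"
  have cont: "continuous_map (subtopology X (\<Union>I)) euclideanreal f" and C: "?C \<in> I"
    and z: "\<And>x. x \<notin> \<Union>I \<Longrightarrow> f x = 0"
    using f by (auto simp: test_functions_def)
  have UI: "\<Union>I \<subseteq> topspace X" using op by (rule openin_subset)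
  have inC: "x \<in> ?C" if "x \<in> topspace X" "f x \<noteq> 0" for x
  proof -
    have "topspace X \<inter> {x. f x \<noteq> 0} \<subseteq> ?C" by (rule closure_of_subset_Int)
    with that show ?thesis by auto
  qed
  show ?thesis
    unfolding continuous_map
  proof (intro conjI allI impI)
    show "f ` topspace X \<subseteq> topspace euclideanreal" by simp
    fix V :: "real set" assume V: "openin euclideanreal V"
    have "openin (subtopology X (\<Union>I)) {x \<in> topspace (subtopology X (\<Union>I)). f x \<in> V}"
      using openin_continuous_map_preimage[OF cont V] .
    then have A: "openin X {x \<in> topspace (subtopology X (\<Union>I)). f x \<in> V}"
      using openin_open_subtopology[OF op] by blast
    have B: "openin X (topspace X - ?C)" by (simp add: openin_diff)
    show "openin X {x \<in> topspace X. f x \<in> V}"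
    proof (cases "0 \<in> V")
      case True
      have "{x \<in> topspace X. f x \<in> V}
          = {x \<in> topspace (subtopology X (\<Union>I)). f x \<in> V} \<union> (topspace X - ?C)"
        using True inC UI C by auto force
      then show ?thesis using openin_Un[OF A B] by simp
    next
      case False
      then have "{x \<in> topspace X. f x \<in> V} = {x \<in> topspace (subtopology X (\<Union>I)). f x \<in> V}"
        using z by auto metis
      then show ?thesis using A by simp
    qed
  qed
qed

lemma test_functionsI:
  assumes "continuous_map X euclideanreal f" "bounded (range f)"
    and A: "A \<in> I" "ideal_on (topspace X) I" and cl: "closedin X A"
    and supp: "\<And>x. f x \<noteq> 0 \<Longrightarrow> x \<in> A"
  shows "f \<in> test_functions X I"
proof -
  have "X closure_of {x. f x \<noteq> 0} \<subseteq> A"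
    by (rule closure_of_minimal) (use cl supp in auto)
  then have "X closure_of {x. f x \<noteq> 0} \<in> I"
    using A by (auto simp: ideal_on_def)
  then show ?thesis
    using assms by (auto simp: test_functions_def continuous_map_from_subtopology)
qed

section \<open>The Hausdorff metric on compact sets\<close>

lemma hausdorff_dist_lessE:
  assumes "hausdorff_dist K L < c"
  obtains e where "e > 0" "ennreal e < c" "K \<subseteq> (\<Union>x\<in>L. cball x e)" "L \<subseteq> (\<Union>x\<in>K. cball x e)"
  using assms unfolding hausdorff_dist_def Inf_less_iff by blast

lemma hausdorff_dist_le:
  assumes "e > 0" "K \<subseteq> (\<Union>x\<in>L. cball x e)" "L \<subseteq> (\<Union>x\<in>K. cball x e)"
  shows "hausdorff_dist K L \<le> ennreal e"
  unfolding hausdorff_dist_def by (rule Inf_lower) (use assms in blast)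

lemma hausdorff_dist_commute: "hausdorff_dist K L = hausdorff_dist L K"
  unfolding hausdorff_dist_def by (intro arg_cong[where f=Inf]) blast

lemma cball_cover_trans:
  fixes K L M :: "'a::metric_space set"
  assumes "K \<subseteq> (\<Union>x\<in>L. cball x a)" "L \<subseteq> (\<Union>x\<in>M. cball x b)"
  shows "K \<subseteq> (\<Union>x\<in>M. cball x (a + b))"
proof
  fix z assume "z \<in> K"
  then obtain y where y: "y \<in> L" "dist y z \<le> a" using assms(1) by auto
  then obtain x where "x \<in> M" "dist x y \<le> b" using assms(2) by (auto simp: subset_iff)
  moreover have "dist x z \<le> a + b" using dist_triangle[of x z y] y calculation by linarith
  ultimately show "z \<in> (\<Union>x\<in>M. cball x (a + b))" by auto
qed

lemma hausdorff_dist_triangle: "hausdorff_dist K M \<le> hausdorff_dist K L + hausdorff_dist L M"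
proof (cases "hausdorff_dist K L < top \<and> hausdorff_dist L M < top")
  case True
  show ?thesis
  proof (rule ennreal_le_epsilon)
    fix e :: real assume e: "0 < e"
    have less: "x < x + ennreal (e/2)" if "x < top" for x
      using that e ennreal_add_left_cancel_less[of x 0 "ennreal (e/2)"] by auto
    obtain a where a: "a > 0" "ennreal a < hausdorff_dist K L + ennreal (e/2)"
      "K \<subseteq> (\<Union>x\<in>L. cball x a)" "L \<subseteq> (\<Union>x\<in>K. cball x a)"
      using True less hausdorff_dist_lessE by metis
    obtain b where b: "b > 0" "ennreal b < hausdorff_dist L M + ennreal (e/2)"
      "L \<subseteq> (\<Union>x\<in>M. cball x b)" "M \<subseteq> (\<Union>x\<in>L. cball x b)"
      using True less hausdorff_dist_lessE by metis
    have "hausdorff_dist K M \<le> ennreal (a + b)"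
    proof (rule hausdorff_dist_le)
      show "K \<subseteq> (\<Union>x\<in>M. cball x (a + b))" using cball_cover_trans[OF a(3) b(3)] .
      show "M \<subseteq> (\<Union>x\<in>K. cball x (a + b))"
        using cball_cover_trans[OF b(4) a(4)] by (simp add: add.commute)
    qed (use a b in auto)
    also have "\<dots> = ennreal a + ennreal b" using a b by simp
    also have "\<dots> \<le> (hausdorff_dist K L + ennreal (e/2)) + (hausdorff_dist L M + ennreal (e/2))"
      using a b by (intro add_mono) auto
    also have "\<dots> = hausdorff_dist K L + hausdorff_dist L M + (ennreal (e/2) + ennreal (e/2))"
      by (simp add: ac_simps)
    also have "ennreal (e/2) + ennreal (e/2) = ennreal e"
      using e by (subst ennreal_plus[symmetric]) auto
    finally show "hausdorff_dist K M \<le> hausdorff_dist K L + hausdorff_dist L M + ennreal e" .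
  qed
next
  case False
  then have "hausdorff_dist K L + hausdorff_dist L M = top" by (auto simp: less_top[symmetric])
  then show ?thesis by (metis top_greatest)
qed

lemma hausdorff_dist_refl [simp]: "hausdorff_dist K K = 0"
proof -
  have "hausdorff_dist K K \<le> 0"
  proof (rule ennreal_le_epsilon)
    fix e :: real assume e: "0 < e"
    have "hausdorff_dist K K \<le> ennreal e" by (rule hausdorff_dist_le) (use e in force)+
    then show "hausdorff_dist K K \<le> 0 + ennreal e" by simp
  qed
  then show ?thesis by simp
qed

lemma hausdorff_dist_zero_imp_subset:
  assumes "closed L" "hausdorff_dist K L = 0"
  shows "K \<subseteq> L"
proof
  fix x assume x: "x \<in> K"
  have "x \<in> closure L"
    unfolding closure_approachable
  proof (intro allI impI)
    fix e :: real assume "0 < e"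
    then have "hausdorff_dist K L < ennreal e" using assms by simp
    then obtain d where "d > 0" "ennreal d < ennreal e" "K \<subseteq> (\<Union>x\<in>L. cball x d)"
      by (rule hausdorff_dist_lessE)
    then show "\<exists>y\<in>L. dist y x < e" using x by (force simp: ennreal_less_iff)
  qed
  then show "x \<in> L" using assms by simp
qed

text \<open>Truncating at \<open>1\<close> makes the extended distance a real-valued metric with the same small balls.\<close>

definition bounded_hausdorff :: "'a::euclidean_space set \<Rightarrow> 'a set \<Rightarrow> real" where
  "bounded_hausdorff K L = enn2real (min 1 (hausdorff_dist K L))"

lemma bounded_hausdorff_less_iff:
  assumes "0 < e" "e \<le> 1"
  shows "bounded_hausdorff K L < e \<longleftrightarrow> hausdorff_dist K L < ennreal e"
proof -
  have fin: "min 1 (hausdorff_dist K L) < top"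
    by (rule le_less_trans[of _ 1]) auto
  have "bounded_hausdorff K L < e \<longleftrightarrow> min 1 (hausdorff_dist K L) < ennreal e"
    unfolding bounded_hausdorff_def
    using fin assms(1) by (cases "min 1 (hausdorff_dist K L)") (auto simp: ennreal_less_iff)
  also have "\<dots> \<longleftrightarrow> hausdorff_dist K L < ennreal e"
    using assms by (auto simp: min_less_iff_disj)
  finally show ?thesis .
qed

lemma Metric_space_bounded_hausdorff:
  "Metric_space (Collect compact) (bounded_hausdorff :: 'a::euclidean_space set \<Rightarrow> _)"
proof
  fix K L M :: "'a set"
  show "0 \<le> bounded_hausdorff K L" by (simp add: bounded_hausdorff_def)
  show "bounded_hausdorff K L = bounded_hausdorff L K"
    by (simp add: bounded_hausdorff_def hausdorff_dist_commute)
  have top: "min 1 x < top" for x :: ennreal by (rule le_less_trans[of _ 1]) auto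
  assume K: "K \<in> Collect compact" and L: "L \<in> Collect compact" and M: "M \<in> Collect compact"
  show "(bounded_hausdorff K L = 0) \<longleftrightarrow> (K = L)"
  proof
    assume "bounded_hausdorff K L = 0"
    then have "min 1 (hausdorff_dist K L) = 0"
      using top[of "hausdorff_dist K L"] by (auto simp: bounded_hausdorff_def enn2real_eq_0_iff)
    then have "hausdorff_dist K L = 0" by (auto simp: min_def split: if_splits)
    then show "K = L"
      using hausdorff_dist_zero_imp_subset[of L K] hausdorff_dist_zero_imp_subset[of K L] K L
      by (auto simp: hausdorff_dist_commute compact_imp_closed)
  qed (simp add: bounded_hausdorff_def)
  have "min 1 (hausdorff_dist K M) \<le> min 1 (hausdorff_dist K L + hausdorff_dist L M)"
    using hausdorff_dist_triangle by (intro min.mono) auto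
  also have "\<dots> \<le> min 1 (hausdorff_dist K L) + min 1 (hausdorff_dist L M)"
    by (auto simp: min_def add_increasing add_increasing2)
  finally have "bounded_hausdorff K M
      \<le> enn2real (min 1 (hausdorff_dist K L) + min 1 (hausdorff_dist L M))"
    unfolding bounded_hausdorff_def by (intro enn2real_mono) (use top in auto)
  also have "\<dots> = bounded_hausdorff K L + bounded_hausdorff L M"
    unfolding bounded_hausdorff_def by (rule enn2real_plus) (use top in auto)
  finally show "bounded_hausdorff K M \<le> bounded_hausdorff K L + bounded_hausdorff L M" .
qed

lemma topspace_hausdorff_topology [simp]: "topspace hausdorff_topology = Collect compact"
proof -
  let ?B = "{{L. compact L \<and> hausdorff_dist K L < ennreal e} | K e. compact (K::'a set) \<and> e > 0}"
  have "K \<in> \<Union>?B" if "compact K" for K :: "'a set"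
  proof
    show "{L. compact L \<and> hausdorff_dist K L < ennreal 1} \<in> ?B" using that zero_less_one by blast
  qed (use that in simp)
  moreover have "\<Union>?B \<subseteq> Collect compact" by blast
  ultimately show ?thesis
    unfolding hausdorff_topology_def topology_generated_by_topspace by blast
qed

lemma openin_hausdorff_ball:
  "compact K \<Longrightarrow> 0 < e \<Longrightarrow> openin hausdorff_topology {L. compact L \<and> hausdorff_dist K L < ennreal e}"
  unfolding hausdorff_topology_def by (rule topology_generated_by_Basis) blast

text \<open>
  The generating balls are all those of the extended distance. Those of radius at most \<open>1\<close> are balls
  of the truncated metric, and by the triangle inequality each larger one is a union of these.
\<close>
lemma hausdorff_topology_eq_mtopology:
  "hausdorff_topology = Metric_space.mtopology (Collect compact) bounded_hausdorff"
proof -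
  interpret Metric_space "Collect compact" "bounded_hausdorff :: 'a set \<Rightarrow> _"
    by (rule Metric_space_bounded_hausdorff)
  have gen: "openin mtopology {L. compact L \<and> hausdorff_dist K L < ennreal e}"
    if "compact K" "e > 0" for K :: "'a set" and e
    unfolding openin_mtopology
  proof (intro conjI allI impI)
    fix L assume L: "L \<in> {L. compact L \<and> hausdorff_dist K L < ennreal e}"
    then have "hausdorff_dist K L < ennreal e" by simp
    then obtain a where a: "hausdorff_dist K L = ennreal a" "0 \<le> a" "a < e"
      by (cases "hausdorff_dist K L") (auto simp: ennreal_less_iff)
    define r where "r = min 1 (e - a)"
    have r: "0 < r" "r \<le> 1" "a + r \<le> e" using a by (auto simp: r_def)
    have "mball L r \<subseteq> {L. compact L \<and> hausdorff_dist K L < ennreal e}"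
    proof
      fix M assume M: "M \<in> mball L r"
      then have "hausdorff_dist L M < ennreal r"
        using bounded_hausdorff_less_iff[OF r(1,2), of L M] by simp
      have "hausdorff_dist K M \<le> hausdorff_dist K L + hausdorff_dist L M"
        by (rule hausdorff_dist_triangle)
      also have "\<dots> < ennreal a + ennreal r"
        unfolding a(1) using \<open>hausdorff_dist L M < ennreal r\<close>
        by (subst ennreal_add_left_cancel_less) auto
      also have "\<dots> \<le> ennreal e" using r a by (simp add: ennreal_leI flip: ennreal_plus)
      finally show "M \<in> {L. compact L \<and> hausdorff_dist K L < ennreal e}" using M by simp
    qed
    then show "\<exists>r>0. mball L r \<subseteq> {L. compact L \<and> hausdorff_dist K L < ennreal e}"
      using r by blast
  qed auto
  have "openin hausdorff_topology U \<longleftrightarrow> openin mtopology U" for U :: "'a set set"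
  proof
    assume "openin hausdorff_topology U"
    then have "generate_topology_on
        {{L. compact L \<and> hausdorff_dist K L < ennreal \<epsilon>} | K \<epsilon>. compact (K::'a set) \<and> \<epsilon> > 0} U"
      unfolding hausdorff_topology_def by (rule openin_topology_generated_by)
    then show "openin mtopology U"
      by (rule generate_topology_on_coarsest[rotated 2]) (use gen in auto)
  next
    assume U: "openin mtopology U"
    show "openin hausdorff_topology U"
    proof (subst openin_subopen, intro ballI)
      fix K assume K: "K \<in> U"
      then have cK: "compact K" using U by (auto simp: openin_mtopology)
      obtain r where r: "r > 0" "mball K r \<subseteq> U" using U K by (auto simp: openin_mtopology)
      define e where "e = min r 1"
      have e: "0 < e" "e \<le> 1" "e \<le> r" using r by (auto simp: e_def)
      have "bounded_hausdorff K L < r" if "hausdorff_dist K L < ennreal e" for L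
        using bounded_hausdorff_less_iff[OF e(1,2), of K L] e(3) that by simp
      then have "{L. compact L \<and> hausdorff_dist K L < ennreal e} \<subseteq> mball K r"
        using cK by auto
      then show "\<exists>T. openin hausdorff_topology T \<and> K \<in> T \<and> T \<subseteq> U"
        using openin_hausdorff_ball[OF cK e(1)] cK e(1) r(2)
        by (intro exI[of _ "{L. compact L \<and> hausdorff_dist K L < ennreal e}"]) auto
    qed
  qed
  then show ?thesis by (simp add: topology_eq)
qed

lemma metrizable_hausdorff_topology: "metrizable_space hausdorff_topology"
  unfolding hausdorff_topology_eq_mtopology
  by (rule Metric_space.metrizable_space_mtopology[OF Metric_space_bounded_hausdorff])

lemma hausdorff_dist_less_if_covers:
  assumes "0 < e" "K \<subseteq> (\<Union>x\<in>L. cball x (e/2))" "L \<subseteq> (\<Union>x\<in>K. cball x (e/2))"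
  shows "hausdorff_dist K L < ennreal e"
proof -
  have "hausdorff_dist K L \<le> ennreal (e/2)" using assms by (intro hausdorff_dist_le) auto
  also have "\<dots> < ennreal e" using assms by (simp add: ennreal_less_iff)
  finally show ?thesis .
qed

lemma continuous_map_hausdorff_topologyI:
  fixes f :: "'b \<Rightarrow> 'a::euclidean_space set"
  assumes "\<And>x. x \<in> topspace X \<Longrightarrow> compact (f x)"
    and ev: "\<And>x e. x \<in> topspace X \<Longrightarrow> 0 < e \<Longrightarrow>
      \<forall>\<^sub>F y in nhdsin X x. f x \<subseteq> (\<Union>z\<in>f y. cball z e) \<and> f y \<subseteq> (\<Union>z\<in>f x. cball z e)"
  shows "continuous_map X hausdorff_topology f"
  unfolding continuous_map
proof (intro conjI allI impI)
  show "f ` topspace X \<subseteq> topspace hausdorff_topology" using assms(1) by auto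
  fix U :: "'a set set" assume U: "openin hausdorff_topology U"
  interpret Metric_space "Collect compact" "bounded_hausdorff :: 'a set \<Rightarrow> _"
    by (rule Metric_space_bounded_hausdorff)
  show "openin X {x \<in> topspace X. f x \<in> U}"
  proof (subst openin_iff_eventually_nhdsin, blast, intro ballI)
    fix x assume x: "x \<in> {x \<in> topspace X. f x \<in> U}"
    then obtain r where r: "r > 0" "mball (f x) r \<subseteq> U"
      using U unfolding hausdorff_topology_eq_mtopology openin_mtopology by blast
    define e where "e = min r 1"
    have e: "0 < e" "e \<le> 1" "e \<le> r" using r by (auto simp: e_def)
    have top: "\<forall>\<^sub>F y in nhdsin X x. y \<in> topspace X"
      using x openin_topspace unfolding eventually_nhdsin by blast
    from e have "0 < e/2" by simp
    with ev[of x "e/2"] x have "\<forall>\<^sub>F y in nhdsin X x.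
        f x \<subseteq> (\<Union>z\<in>f y. cball z (e/2)) \<and> f y \<subseteq> (\<Union>z\<in>f x. cball z (e/2))" by blast
    with top have "\<forall>\<^sub>F y in nhdsin X x. y \<in> topspace X \<and> hausdorff_dist (f x) (f y) < ennreal e"
      by eventually_elim (use hausdorff_dist_less_if_covers[OF e(1)] in blast)
    then show "\<forall>\<^sub>F y in nhdsin X x. y \<in> {x \<in> topspace X. f x \<in> U}"
    proof (rule eventually_mono)
      fix y assume y: "y \<in> topspace X \<and> hausdorff_dist (f x) (f y) < ennreal e"
      then have "bounded_hausdorff (f x) (f y) < r"
        using bounded_hausdorff_less_iff[OF e(1,2), of "f x" "f y"] e(3) by simp
      then have "f y \<in> mball (f x) r" using assms(1) x y by simp
      then show "y \<in> {x \<in> topspace X. f x \<in> U}" using r y by auto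
    qed
  qed
qed

lemma scaling_on_set_scaling: "scaling_on hausdorff_topology set_scaling"
  unfolding scaling_on_def
proof (intro conjI allI impI ballI)
  fix t :: real assume t: "0 < t"
  show "continuous_map hausdorff_topology hausdorff_topology (set_scaling t :: 'a set \<Rightarrow> _)"
  proof (rule continuous_map_hausdorff_topologyI)
    fix K :: "'a set" assume "K \<in> topspace hausdorff_topology"
    then have K: "compact K" by simp
    then show "compact (set_scaling t K)"
      unfolding set_scaling_def by (rule compact_scaling)
    fix e :: real assume e: "0 < e"
    have cov: "set_scaling t A \<subseteq> (\<Union>z\<in>set_scaling t B. cball z e)"
      if AB: "A \<subseteq> (\<Union>x\<in>B. cball x d)" and d: "d \<le> e / t" for A B :: "'a set" and d
    proof
      fix z assume "z \<in> set_scaling t A"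
      then obtain y where y: "y \<in> A" "z = t *\<^sub>R y" by (auto simp: set_scaling_def)
      then obtain x where x: "x \<in> B" "dist x y \<le> d" using AB by auto
      have "dist (t *\<^sub>R x) (t *\<^sub>R y) = t * dist x y"
        using t by (simp add: dist_norm flip: scaleR_diff_right)
      also have "\<dots> \<le> t * (e / t)" using x d t by (intro mult_left_mono) auto
      finally show "z \<in> (\<Union>z\<in>set_scaling t B. cball z e)"
        using x y t by (auto simp: set_scaling_def)
    qed
    have "openin hausdorff_topology {L. compact L \<and> hausdorff_dist K L < ennreal (e / t)}"
      using K e t by (intro openin_hausdorff_ball) auto
    then have "\<forall>\<^sub>F L in nhdsin hausdorff_topology K. hausdorff_dist K L < ennreal (e / t)"
      unfolding eventually_nhdsin using K e t
      by (intro disjI2 exI[of _ "{L. compact L \<and> hausdorff_dist K L < ennreal (e / t)}"]) auto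
    then show "\<forall>\<^sub>F L in nhdsin hausdorff_topology K.
        set_scaling t K \<subseteq> (\<Union>z\<in>set_scaling t L. cball z e) \<and>
        set_scaling t L \<subseteq> (\<Union>z\<in>set_scaling t K. cball z e)"
    proof (rule eventually_mono)
      fix L assume "hausdorff_dist K L < ennreal (e / t)"
      then obtain d where "d > 0" "ennreal d < ennreal (e / t)"
        "K \<subseteq> (\<Union>x\<in>L. cball x d)" "L \<subseteq> (\<Union>x\<in>K. cball x d)"
        by (rule hausdorff_dist_lessE)
      moreover from this have "d \<le> e / t" by (simp add: ennreal_less_iff)
      ultimately show "set_scaling t K \<subseteq> (\<Union>z\<in>set_scaling t L. cball z e) \<and>
        set_scaling t L \<subseteq> (\<Union>z\<in>set_scaling t K. cball z e)"
        using cov by blast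
    qed
  qed
qed (auto simp: set_scaling_def image_image)

section \<open>Distance of a compact set to the subspaces of fixed dimension\<close>

lemma subspace_dist_le:
  assumes "subspace H" "dim H = j" "compact L" "L \<subseteq> H"
  shows "subspace_dist j K \<le> hausdorff_dist K L"
  unfolding subspace_dist_def using assms by (intro INF_lower2[of H] INF_lower2[of L]) auto

lemma subspace_dist_triangle: "subspace_dist j K \<le> hausdorff_dist K K' + subspace_dist j K'"
proof (rule ennreal_le_epsilon)
  fix e :: real assume "hausdorff_dist K K' + subspace_dist j K' < top" and e: "0 < e"
  then have "subspace_dist j K' < top" by simp
  then have "subspace_dist j K' < subspace_dist j K' + ennreal e"
    using e ennreal_add_left_cancel_less[of "subspace_dist j K'" 0 "ennreal e"] by auto
  then obtain H L where HL: "subspace H" "dim H = j" "compact L" "L \<subseteq> H"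
    "hausdorff_dist K' L < subspace_dist j K' + ennreal e"
    unfolding subspace_dist_def[of j K'] INF_less_iff by blast
  have "subspace_dist j K \<le> hausdorff_dist K L" using HL by (intro subspace_dist_le)
  also have "\<dots> \<le> hausdorff_dist K K' + hausdorff_dist K' L" by (rule hausdorff_dist_triangle)
  also have "\<dots> \<le> hausdorff_dist K K' + (subspace_dist j K' + ennreal e)"
    using HL by (intro add_mono) auto
  finally show "subspace_dist j K \<le> hausdorff_dist K K' + subspace_dist j K' + ennreal e"
    by (simp add: add.assoc)
qed

lemma ideal_on_subspace_ideal: "ideal_on (topspace hausdorff_topology) (subspace_ideal j)"
  unfolding ideal_on_def
proof (intro conjI ballI allI impI)
  fix A B :: "'a set set" assume A: "A \<in> subspace_ideal j"
  {
    assume "B \<in> subspace_ideal j"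
    with A show "A \<union> B \<in> subspace_ideal j" by (auto simp: subspace_ideal_def INF_union inf_min)
  next
    assume "B \<subseteq> A"
    then have "(INF K\<in>A. subspace_dist j K) \<le> (INF K\<in>B. subspace_dist j K)"
      by (intro INF_superset_mono) auto
    with A \<open>B \<subseteq> A\<close> show "B \<in> subspace_ideal j"
      by (auto simp: subspace_ideal_def dest: order.strict_trans2)
  }
qed (auto simp: subspace_ideal_def)

lemma Union_subspace_ideal: "\<Union>(subspace_ideal j) = {K. compact K \<and> subspace_dist j K > 0}"
proof (intro set_eqI iffI)
  fix K :: "'a set" assume "K \<in> \<Union>(subspace_ideal j)"
  then obtain A where "A \<in> subspace_ideal j" "K \<in> A" by blast
  then show "K \<in> {K. compact K \<and> subspace_dist j K > 0}"
    unfolding subspace_ideal_def by (auto dest: order.strict_trans2 intro: INF_lower)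
next
  fix K :: "'a set" assume "K \<in> {K. compact K \<and> subspace_dist j K > 0}"
  then have "{K} \<in> subspace_ideal j" by (auto simp: subspace_ideal_def)
  then show "K \<in> \<Union>(subspace_ideal j)" by blast
qed

lemma ennreal_pos_lower_bound:
  assumes "0 < (x::ennreal)"
  obtains e where "0 < e" "ennreal e \<le> x"
proof (cases x)
  case (real r)
  with assms that[of r] show ?thesis by auto
next
  case top
  with that[of 1] show ?thesis by simp
qed

text \<open>
  By the triangle inequality a set at distance \<open>0\<close> from the subspaces cannot be closer to \<open>K\<close> than they are.
\<close>
lemma openin_Union_subspace_ideal: "openin hausdorff_topology (\<Union>(subspace_ideal j))"
proof (subst openin_subopen, intro ballI)
  fix K :: "'a set" assume "K \<in> \<Union>(subspace_ideal j)"
  then have K: "compact K" "subspace_dist j K > 0" by (auto simp: Union_subspace_ideal)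
  obtain e where e: "0 < e" "ennreal e \<le> subspace_dist j K"
    using ennreal_pos_lower_bound[OF K(2)] .
  have "{L. compact L \<and> hausdorff_dist K L < ennreal e} \<subseteq> \<Union>(subspace_ideal j)"
  proof
    fix L assume "L \<in> {L. compact L \<and> hausdorff_dist K L < ennreal e}"
    then have L: "compact L" "hausdorff_dist K L < subspace_dist j K" using e(2) by auto
    have "subspace_dist j L \<noteq> 0"
      using subspace_dist_triangle[of j K L] L(2) by auto
    then show "L \<in> \<Union>(subspace_ideal j)"
      using L by (auto simp: Union_subspace_ideal zero_less_iff_neq_zero)
  qed
  then show "\<exists>T. openin hausdorff_topology T \<and> K \<in> T \<and> T \<subseteq> \<Union>(subspace_ideal j)"
    using openin_hausdorff_ball[OF K(1) e(1)] K e(1)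
    by (intro exI[of _ "{L. compact L \<and> hausdorff_dist K L < ennreal e}"]) auto
qed

lemma subspace_ideal_lower_bound:
  assumes "A \<in> subspace_ideal j"
  obtains c where "0 < c" "\<forall>K\<in>A. ennreal c \<le> subspace_dist j K"
proof -
  have "0 < (INF K\<in>A. subspace_dist j K)" using assms by (simp add: subspace_ideal_def)
  then obtain c where "0 < c" "ennreal c \<le> (INF K\<in>A. subspace_dist j K)"
    by (rule ennreal_pos_lower_bound)
  with that show ?thesis by (auto simp: le_INF_iff)
qed

lemma subspace_of_dim_containing:
  fixes S :: "'a::euclidean_space set"
  assumes "finite S" "card S \<le> j" "j \<le> DIM('a)"
  obtains H where "subspace H" "dim H = j" "S \<subseteq> H"
proof -
  obtain B where B: "B \<subseteq> S" "independent B" "S \<subseteq> span B"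
    using maximal_independent_subset[of S] by metis
  obtain C where C: "B \<subseteq> C" "independent C" "UNIV \<subseteq> span C"
    using maximal_independent_subset_extend[of B UNIV] B(2) by (metis subset_UNIV)
  have fC: "finite C" using independent_imp_finite[OF C(2)] .
  have cC: "card C = DIM('a)"
    using C by (metis dim_UNIV dim_eq_card_independent dim_span top.extremum_uniqueI)
  have "card B \<le> j" using B(1) assms card_mono[of S B] by linarith
  then obtain D where D: "B \<subseteq> D" "D \<subseteq> C" "card D = j"
    using exists_subset_between[of B j C] C(1) fC cC assms by auto
  have "independent D" using C(2) D(2) by (rule independent_mono)
  then have "dim (span D) = j" using D by (simp add: dim_eq_card_independent)
  moreover have "S \<subseteq> span D" using B(3) span_mono[OF D(1)] by blast
  ultimately show ?thesis using that[of "span D"] by simp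
qed

text \<open>
  Take a subspace \<open>H\<close> containing the few points of \<open>K\<close> outside the ball. Projecting to \<open>H\<close> moves those
  points not at all and the others by at most the radius, as \<open>H\<close> contains the origin.
\<close>
lemma subspace_dist_le_if_few_large_points:
  fixes K :: "'a::euclidean_space set"
  assumes "compact K" "0 < e" "finite {x\<in>K. norm x > e}" "card {x\<in>K. norm x > e} \<le> j"
    and "j \<le> DIM('a)"
  shows "subspace_dist j K \<le> ennreal e"
proof -
  obtain H where H: "subspace H" "dim H = j" "{x\<in>K. norm x > e} \<subseteq> H"
    using subspace_of_dim_containing[OF assms(3-5)] .
  have cl: "closed H" "H \<noteq> {}" "convex H"
    using closed_subspace[OF H(1)] subspace_0[OF H(1)] subspace_imp_convex[OF H(1)] by auto
  define p where "p = closest_point H"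
  have pH: "p x \<in> H" for x unfolding p_def using cl by (intro closest_point_in_set)
  have dist: "dist x (p x) \<le> e" if "x \<in> K" for x
  proof (cases "norm x > e")
    case True
    then have "p x = x" using that H(3) unfolding p_def by (intro closest_point_self) auto
    then show ?thesis using assms by simp
  next
    case False
    have "dist x (p x) \<le> dist x 0"
      unfolding p_def using cl H by (intro closest_point_le) (auto simp: subspace_0)
    with False show ?thesis by simp
  qed
  have "compact (p ` K)"
    unfolding p_def using assms(1) cl by (intro compact_continuous_image continuous_on_closest_point)
  then have "subspace_dist j K \<le> hausdorff_dist K (p ` K)"
    using H pH by (intro subspace_dist_le) auto
  also have "\<dots> \<le> ennreal e"
    using assms(2) dist by (intro hausdorff_dist_le) (auto simp: dist_commute)
  finally show ?thesis .
qed

section \<open>Counting measures and their atoms\<close>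

lemma away_from_zero_iff: "A \<in> away_from_zero \<longleftrightarrow> (\<exists>s>0. \<forall>x\<in>A. s \<le> norm x)"
proof
  assume "A \<in> away_from_zero"
  then have "0 < (INF x\<in>A. ennreal (norm x))" by (simp add: away_from_zero_def)
  then obtain s where "0 < s" "ennreal s \<le> (INF x\<in>A. ennreal (norm x))"
    by (rule ennreal_pos_lower_bound)
  then show "\<exists>s>0. \<forall>x\<in>A. s \<le> norm x" by (auto simp: le_INF_iff)
next
  assume "\<exists>s>0. \<forall>x\<in>A. s \<le> norm x"
  then obtain s where s: "0 < s" "\<And>x. x \<in> A \<Longrightarrow> s \<le> norm x" by blast
  have "0 < ennreal s" using s by simp
  also have "\<dots> \<le> (INF x\<in>A. ennreal (norm x))" using s by (intro INF_greatest) auto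
  finally show "A \<in> away_from_zero" by (simp add: away_from_zero_def)
qed

lemma ideal_on_away_from_zero: "ideal_on UNIV away_from_zero"
  unfolding ideal_on_def
proof (intro conjI ballI allI impI)
  fix A B :: "'a set" assume "A \<in> away_from_zero" "B \<in> away_from_zero"
  then obtain s t where "0 < s" "\<forall>x\<in>A. s \<le> norm x" "0 < t" "\<forall>x\<in>B. t \<le> norm x"
    unfolding away_from_zero_iff by blast
  then have "0 < min s t \<and> (\<forall>x\<in>A \<union> B. min s t \<le> norm x)" by auto
  then show "A \<union> B \<in> away_from_zero" unfolding away_from_zero_iff by blast
qed (auto simp: away_from_zero_iff intro: exI[of _ 1])

lemma zero_notin_away_from_zero: "0 \<notin> \<Union>away_from_zero"
  by (force simp: away_from_zero_iff)

lemma space_punctured [simp]: "space punctured = - {0}"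
  by (auto simp: punctured_def space_restrict_space)

lemma sets_punctured: "A \<in> sets punctured \<longleftrightarrow> A \<in> sets borel \<and> 0 \<notin> A"
  by (auto simp: punctured_def sets_restrict_space_iff)

lemma sets_outside_ball:
  assumes "0 < s"
  shows "{x. s \<le> norm x} \<in> sets borel" "{x. s \<le> norm x} \<in> away_from_zero"
  using assms by (auto simp: away_from_zero_iff)

lemma vague_test_functionI:
  fixes f :: "'a::euclidean_space \<Rightarrow> real"
  assumes "continuous_on UNIV f" "\<And>x. \<bar>f x\<bar> \<le> b" "0 < s" "\<And>x. f x \<noteq> 0 \<Longrightarrow> s \<le> norm x"
  shows "f \<in> test_functions euclidean away_from_zero"
proof (rule test_functionsI)
  show "bounded (range f)" using assms(2) by (auto simp: bounded_iff)
  have "closed {x::'a. s \<le> norm x}" by (intro closed_Collect_le continuous_intros)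
  then show "closedin euclidean {x::'a. s \<le> norm x}" by simp
  show "{x::'a. s \<le> norm x} \<in> away_from_zero" using sets_outside_ball assms(3) by blast
qed (use assms ideal_on_away_from_zero in auto)

definition bump :: "'a::euclidean_space set \<Rightarrow> real \<Rightarrow> 'a \<Rightarrow> real" where
  "bump C \<delta> x = max 0 (1 - infdist x C / \<delta>)"

lemma bump_nonneg: "0 \<le> bump C \<delta> x" and bump_le_1: "0 < \<delta> \<Longrightarrow> bump C \<delta> x \<le> 1"
  by (auto simp: bump_def infdist_nonneg)

lemma bump_eq_1: "x \<in> C \<Longrightarrow> bump C \<delta> x = 1"
  by (simp add: bump_def)

lemma bump_eq_0_iff: "0 < \<delta> \<Longrightarrow> bump C \<delta> x = 0 \<longleftrightarrow> \<delta> \<le> infdist x C"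
  by (auto simp: bump_def max_def field_simps)

lemma bump_test_function:
  assumes "C \<noteq> {}" "0 < \<delta>" "\<And>x. x \<in> C \<Longrightarrow> s + \<delta> \<le> norm x" "0 < s"
  shows "bump C \<delta> \<in> test_functions euclidean away_from_zero"
    and "bump C \<delta> x \<noteq> 0 \<Longrightarrow> s \<le> norm x"
proof -
  have far: "s \<le> norm x" if nz: "bump C \<delta> x \<noteq> 0" for x
  proof -
    have "infdist x C < \<delta>" using nz bump_eq_0_iff[OF assms(2), of C x] by linarith
    then obtain y where "y \<in> C" "dist x y < \<delta>"
      using assms(1) by (auto simp: infdist_notempty cINF_less_iff)
    then show ?thesis
      using assms(3)[of y] norm_triangle_ineq2[of y x] by (simp add: dist_norm norm_minus_commute)
  qed
  then show "bump C \<delta> x \<noteq> 0 \<Longrightarrow> s \<le> norm x" .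
  show "bump C \<delta> \<in> test_functions euclidean away_from_zero"
  proof (rule vague_test_functionI[of _ 1 s])
    show "continuous_on UNIV (bump C \<delta>)"
      unfolding bump_def using assms(2) by (intro continuous_intros) auto
    show "\<bar>bump C \<delta> x\<bar> \<le> 1" for x
      using bump_nonneg[of C \<delta> x] bump_le_1[OF assms(2), of C x] by simp
  qed (use far assms in auto)
qed

lemma counting_measuresD:
  assumes "m \<in> counting_measures"
  shows "space m = - {0}" and "A \<in> sets m \<longleftrightarrow> A \<in> sets borel \<and> 0 \<notin> A"
    and "0 < s \<Longrightarrow> emeasure m {x. s \<le> norm x} < \<infinity>"
  using assms sets_outside_ball[of s] by (auto simp: counting_measures_def sets_punctured)

lemma counting_measure_ge_1:
  assumes "m \<in> counting_measures" "emeasure m A \<noteq> 0"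
  shows "1 \<le> emeasure m A"
proof -
  have "A \<in> sets m" using assms(2) emeasure_notin_sets by blast
  then obtain n where n: "emeasure m A = ennreal_of_enat n"
    using assms(1) unfolding counting_measures_def by blast
  then have "n \<noteq> 0" using assms(2) by auto
  then have "1 \<le> n" by (simp add: ileI1 one_eSuc zero_less_iff_neq_zero)
  then have "ennreal_of_enat 1 \<le> ennreal_of_enat n" by (simp only: ennreal_of_enat_le_iff)
  then show ?thesis by (simp add: n)
qed

lemma atom_nonzero: "m \<in> counting_measures \<Longrightarrow> x \<in> atoms m \<Longrightarrow> x \<noteq> 0"
  using counting_measuresD(2)[of m "{x}"] emeasure_notin_sets[of "{x}" m] by (auto simp: atoms_def)

lemma atom_ge_1: "m \<in> counting_measures \<Longrightarrow> x \<in> atoms m \<Longrightarrow> 1 \<le> emeasure m {x}"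
  by (rule counting_measure_ge_1) (auto simp: atoms_def)

text \<open>
  A locally finite integer-valued measure is purely atomic: around a point that is no atom small balls
  have measure below \<open>1\<close>, hence \<open>0\<close>, and countably many such balls cover a set without atoms.
\<close>
lemma counting_measure_null_without_atoms:
  fixes m :: "'a::euclidean_space measure"
  assumes m: "m \<in> counting_measures" and A: "A \<in> sets m" and no: "A \<inter> atoms m = {}"
  shows "emeasure m A = 0"
proof -
  have ex: "\<exists>r>0. ball x r \<in> sets m \<and> emeasure m (ball x r) = 0" if x: "x \<in> A" for x
  proof -
    \<comment> \<open>Radii of at most half the norm keep the balls away from the origin, where \<open>m\<close> may be infinite.\<close>
    define B where "B n = ball x (norm x / (2 + real n))" for n
    have x0: "x \<noteq> 0" and Ab: "A \<in> sets borel" using x A counting_measuresD(2)[OF m] by auto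
    have large: "norm x / 2 \<le> norm y" if "y \<in> B n" for n y
    proof -
      have "norm x / (2 + real n) \<le> norm x / 2" by (intro divide_left_mono) auto
      moreover have "norm (x - y) < norm x / (2 + real n)" using that by (simp add: B_def dist_norm)
      ultimately show ?thesis using norm_triangle_ineq2[of x y] by linarith
    qed
    have Bs: "B n \<in> sets m" for n
      using large[of 0 n] x0 counting_measuresD(2)[OF m, of "B n"] by (auto simp: B_def)
    have dec: "decseq B"
      unfolding B_def by (intro antimonoI subset_ball divide_left_mono) auto
    have fin: "emeasure m (B n) \<noteq> \<infinity>" for n
    proof -
      have "emeasure m (B n) \<le> emeasure m {y. norm x / 2 \<le> norm y}"
        using large x0 counting_measuresD(2)[OF m] by (intro emeasure_mono) auto
      also have "\<dots> < \<infinity>" using x0 by (intro counting_measuresD(3)[OF m]) auto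
      finally show ?thesis by simp
    qed
    have "y = x" if "\<And>n. y \<in> B n" for y
    proof (rule ccontr)
      assume "y \<noteq> x"
      then obtain n where "norm x / dist x y < real n" using reals_Archimedean2 by blast
      then have "norm x < real n * dist x y" using \<open>y \<noteq> x\<close> by (simp add: divide_less_eq)
      then have "norm x < (2 + real n) * dist x y"
        using zero_le_dist[of x y] unfolding distrib_right by linarith
      then have "\<not> dist x y < norm x / (2 + real n)" by (simp add: field_simps)
      then show False using that[of n] by (simp add: B_def)
    qed
    moreover have "x \<in> B n" for n using x0 by (simp add: B_def)
    ultimately have int: "(\<Inter>n. B n) = {x}" by auto
    have "(\<lambda>n. emeasure m (B n)) \<longlonglongrightarrow> emeasure m (\<Inter>n. B n)"
      using Bs dec fin by (intro Lim_emeasure_decseq) auto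
    also have "emeasure m (\<Inter>n. B n) = 0"
      unfolding int using no x by (auto simp: atoms_def zero_less_iff_neq_zero)
    finally have "\<forall>\<^sub>F n in sequentially. emeasure m (B n) < 1"
      by (rule order_tendstoD) simp
    then obtain n where "emeasure m (B n) < 1" by (auto simp: eventually_sequentially)
    then have "emeasure m (B n) = 0"
      using counting_measure_ge_1[OF m, of "B n"] by (auto simp: not_le[symmetric])
    then show ?thesis
      using Bs x0 unfolding B_def by (intro exI[of _ "norm x / (2 + real n)"]) auto
  qed
  define F where "F = {ball x r | x r. ball x r \<in> sets m \<and> emeasure m (ball x r) = 0}"
  obtain F' where F': "F' \<subseteq> F" "countable F'" "\<Union>F' = \<Union>F"
    using Lindelof[of F] by (auto simp: F_def)
  have AF: "A \<subseteq> \<Union>F"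
  proof
    fix x assume "x \<in> A"
    then obtain r where "r > 0" "ball x r \<in> sets m" "emeasure m (ball x r) = 0" using ex by blast
    then show "x \<in> \<Union>F" unfolding F_def by (intro UnionI[of "ball x r"]) auto
  qed
  have null: "\<Union>F' \<in> null_sets m"
    using F'(1,2) by (intro null_sets_UN'[of F' "\<lambda>x. x", simplified]) (auto simp: F_def null_sets_def)
  have "emeasure m A \<le> emeasure m (\<Union>F')"
    using AF F'(3) null by (intro emeasure_mono) auto
  with null show ?thesis by auto
qed

lemma counting_measure_null_iff_no_atoms:
  assumes m: "m \<in> counting_measures"
  shows "m = null_measure punctured \<longleftrightarrow> atoms m = {}"
proof
  assume no: "atoms m = {}"
  show "m = null_measure punctured"
    using counting_measure_null_without_atoms[OF m] no m
    by (intro measure_eqI) (auto simp: counting_measures_def)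
qed (auto simp: atoms_def)

lemma null_measure_counting: "null_measure punctured \<in> counting_measures"
proof -
  have "0 = ennreal_of_enat 0" by simp
  then show ?thesis by (auto simp: counting_measures_def intro!: exI[of _ 0])
qed

lemma card_atoms_le_emeasure:
  assumes m: "m \<in> counting_measures" and S: "finite S" "S \<subseteq> atoms m" "S \<subseteq> A" and A: "A \<in> sets m"
  shows "of_nat (card S) \<le> emeasure m A"
proof -
  have "of_nat (card S) = (\<Sum>x\<in>S. 1::ennreal)" by simp
  also have "\<dots> \<le> (\<Sum>x\<in>S. emeasure m {x})"
    using S atom_ge_1[OF m] by (intro sum_mono) auto
  also have "\<dots> = emeasure m S"
    using S atom_nonzero[OF m] counting_measuresD(2)[OF m]
    by (intro emeasure_eq_sum_singleton[symmetric]) auto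
  also have "\<dots> \<le> emeasure m A" using S A by (intro emeasure_mono)
  finally show ?thesis .
qed

lemma finite_atoms_outside_ball:
  assumes m: "m \<in> counting_measures" and s: "0 < s"
  shows "finite {x \<in> atoms m. s \<le> norm x}"
proof (rule ccontr)
  assume inf: "infinite {x \<in> atoms m. s \<le> norm x}"
  have A: "{x. s \<le> norm x} \<in> sets m" using s counting_measuresD(2)[OF m] by auto
  have fin: "emeasure m {x. s \<le> norm x} < \<infinity>" using counting_measuresD(3)[OF m s] .
  then obtain n :: nat where n: "emeasure m {x. s \<le> norm x} < of_nat n"
    using ennreal_Ex_less_of_nat[of "emeasure m {x. s \<le> norm x}"] by auto
  obtain S where S: "finite S" "card S = n" "S \<subseteq> {x \<in> atoms m. s \<le> norm x}"
    using infinite_arbitrarily_large[OF inf, of n] by blast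
  then have "of_nat n \<le> emeasure m {x. s \<le> norm x}"
    using card_atoms_le_emeasure[OF m S(1) _ _ A] by auto
  with n show False by simp
qed

lemma compact_closure_atoms:
  assumes m: "m \<in> counting_measures"
  shows "compact (closure (atoms m))"
proof -
  have "bounded {x \<in> atoms m. 1 \<le> norm x}"
    using finite_atoms_outside_ball[OF m, of 1] finite_imp_bounded by auto
  then have "bounded ({x \<in> atoms m. 1 \<le> norm x} \<union> ball 0 1)" by simp
  then have "bounded (atoms m)" by (rule bounded_subset) (auto simp: not_le)
  then show ?thesis by (simp add: compact_closure)
qed

lemma integrable_test_function:
  assumes m: "m \<in> counting_measures" and f: "f \<in> test_functions euclidean away_from_zero"
  shows "integrable m f"
proof -
  let ?S = "closure {x. f x \<noteq> 0}"
  have S: "?S \<in> away_from_zero" and bd: "bounded (range f)"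
    and cont: "continuous_map (subtopology euclidean (\<Union>away_from_zero)) euclideanreal f"
    using f by (auto simp: test_functions_def)
  have "0 \<notin> ?S" using S zero_notin_away_from_zero by blast
  then have Sm: "?S \<in> sets m" using counting_measuresD(2)[OF m] by simp
  obtain b where b: "\<And>x. norm (f x) \<le> b" using bd by (auto simp: bounded_iff)
  have U: "\<Union>away_from_zero = - {0::'a}"
  proof -
    have "x \<in> \<Union>away_from_zero" if "x \<noteq> 0" for x :: 'a
      using sets_outside_ball(2)[of "norm x"] that by (intro UnionI[of "{y. norm x \<le> norm y}"]) auto
    then show ?thesis using zero_notin_away_from_zero by blast
  qed
  have "f \<in> borel_measurable (restrict_space borel (- {0}))"
    using cont unfolding U by (intro borel_measurable_continuous_on_restrict) simp
  then have meas: "f \<in> borel_measurable m"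
    using m by (subst measurable_cong_sets[of m punctured borel borel])
      (auto simp: counting_measures_def punctured_def)
  show ?thesis
  proof (rule integrableI_bounded_set[OF Sm meas])
    show "emeasure m ?S < \<infinity>" using m S by (auto simp: counting_measures_def)
    show "AE x in m. x \<in> ?S \<longrightarrow> norm (f x) \<le> b" using b by simp
    show "AE x in m. x \<notin> ?S \<longrightarrow> f x = 0"
      using closure_subset[of "{x. f x \<noteq> 0}"] by (intro AE_I2) auto
  qed
qed

lemma integral_ge_1_if_atom:
  assumes m: "m \<in> counting_measures" and f: "f \<in> test_functions euclidean away_from_zero"
    and nn: "\<And>y. 0 \<le> f y" and x: "x \<in> atoms m" "f x = 1"
  shows "1 \<le> (\<integral>y. f y \<partial>m)"
proof -
  have xs: "{x} \<in> sets m" using atom_nonzero[OF m x(1)] counting_measuresD(2)[OF m] by simp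
  have "emeasure m {x} \<le> emeasure m {y. norm x \<le> norm y}"
    using atom_nonzero[OF m x(1)] counting_measuresD(2)[OF m] by (intro emeasure_mono) auto
  also have "\<dots> < \<infinity>" using atom_nonzero[OF m x(1)] by (intro counting_measuresD(3)[OF m]) auto
  finally have fin: "emeasure m {x} < \<infinity>" .
  have "1 \<le> measure m {x}"
    using atom_ge_1[OF m x(1)] fin by (simp add: emeasure_eq_ennreal_measure less_top)
  also have "\<dots> = (\<integral>y. indicator {x} y \<partial>m)" using xs by simp
  also have "\<dots> \<le> (\<integral>y. f y \<partial>m)"
  proof (rule integral_mono)
    show "integrable m (indicator {x} :: 'a \<Rightarrow> real)"
      using xs fin by (intro integrable_real_indicator) auto
    show "indicator {x} y \<le> f y" for y using nn x by (simp add: indicator_def)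
  qed (rule integrable_test_function[OF m f])
  finally show ?thesis .
qed

lemma integral_eq_0_if_null_on_atoms:
  assumes m: "m \<in> counting_measures" and f: "f \<in> test_functions euclidean away_from_zero"
    and z: "\<And>x. x \<in> atoms m \<Longrightarrow> f x = 0"
  shows "(\<integral>y. f y \<partial>m) = 0"
proof -
  have meas: "f \<in> borel_measurable m" using integrable_test_function[OF m f] by simp
  let ?N = "{x \<in> space m. f x \<noteq> 0}"
  have N: "?N \<in> sets m" using meas by measurable
  then have "emeasure m ?N = 0"
    using z by (intro counting_measure_null_without_atoms[OF m]) auto
  then have "AE x in m. f x = 0" using N by (intro AE_I[of _ _ ?N]) auto
  then show ?thesis by (rule integral_eq_zero_AE)
qed

section \<open>Vague convergence seen from the atoms\<close>

text \<open>
  Limits along filters, since the neighbourhood filters of the vague topology are the ones needed.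
\<close>
definition vague_limit :: "('i \<Rightarrow> 'a::euclidean_space measure) \<Rightarrow> 'a measure \<Rightarrow> 'i filter \<Rightarrow> bool" where
  "vague_limit m m0 F \<longleftrightarrow> m0 \<in> counting_measures \<and> (\<forall>\<^sub>F i in F. m i \<in> counting_measures) \<and>
     (\<forall>f\<in>test_functions euclidean away_from_zero. ((\<lambda>i. \<integral>x. f x \<partial>m i) \<longlongrightarrow> (\<integral>x. f x \<partial>m0)) F)"

lemma topspace_vague_topology [simp]: "topspace vague_topology = counting_measures"
proof -
  have "(\<lambda>x::'a. 0) \<in> test_functions euclidean away_from_zero"
    by (rule vague_test_functionI[of _ 0 1]) auto
  then have "counting_measures \<in> {{m \<in> counting_measures. (\<integral>x. f x \<partial>m) \<in> U} | f U.
        f \<in> test_functions euclidean (away_from_zero :: 'a set set) \<and> open (U :: real set)}"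
    by (intro CollectI exI[of _ "\<lambda>x. 0"] exI[of _ UNIV]) auto
  then show ?thesis
    unfolding vague_topology_def topology_generated_by_topspace by blast
qed

lemma continuous_map_integral_vague:
  assumes "f \<in> test_functions euclidean away_from_zero"
  shows "continuous_map vague_topology euclideanreal (\<lambda>m. \<integral>x. f x \<partial>m)"
  unfolding continuous_map
proof (intro conjI allI impI)
  fix U :: "real set" assume "openin euclideanreal U"
  then show "openin vague_topology {m \<in> topspace vague_topology. (\<integral>x. f x \<partial>m) \<in> U}"
    using assms unfolding topspace_vague_topology unfolding vague_topology_def
    by (intro topology_generated_by_Basis) auto
qed simp

lemma marked_limits:
  assumes S: "S \<subseteq> topspace marked_topology" and p: "p \<in> S"
  shows "vague_limit fst (fst p) (nhdsin (subtopology marked_topology S) p)"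
    and "(snd \<longlongrightarrow> snd p) (nhdsin (subtopology marked_topology S) p)"
    and "\<forall>\<^sub>F q in nhdsin (subtopology marked_topology S) p. q \<in> S"
proof -
  let ?X = "subtopology marked_topology S"
  have pX: "p \<in> topspace ?X" using assms by auto
  show ev: "\<forall>\<^sub>F q in nhdsin ?X p. q \<in> S" by (rule eventually_nhdsin_subtopology[OF S])
  have cs: "S \<subseteq> counting_measures \<times> UNIV" using S by simp
  have fst: "continuous_map ?X vague_topology fst"
    by (intro continuous_map_from_subtopology continuous_map_fst)
  have "((\<lambda>q. \<integral>x. f x \<partial>fst q) \<longlongrightarrow> (\<integral>x. f x \<partial>fst p)) (nhdsin ?X p)"
    if "f \<in> test_functions euclidean away_from_zero" for f
    using continuous_map_compose[OF fst continuous_map_integral_vague[OF that]]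
    by (intro continuous_map_imp_tendsto_nhdsin[OF _ pX]) (simp add: o_def)
  moreover have "\<forall>\<^sub>F q in nhdsin ?X p. fst q \<in> counting_measures"
    using ev by (rule eventually_mono) (use cs in auto)
  ultimately show "vague_limit fst (fst p) (nhdsin ?X p)"
    using p cs by (auto simp: vague_limit_def)
  show "(snd \<longlongrightarrow> snd p) (nhdsin ?X p)"
    by (intro continuous_map_imp_tendsto_nhdsin[OF _ pX] continuous_map_from_subtopology
        continuous_map_snd)
qed

text \<open>A bump function around an atom of the limit has a positive limiting integral.\<close>
lemma vague_limit_atom_near:
  fixes m :: "'i \<Rightarrow> 'a::euclidean_space measure"
  assumes lim: "vague_limit m m0 F" and x0: "x0 \<in> atoms m0" and e: "0 < e"
  shows "\<forall>\<^sub>F i in F. \<exists>x\<in>atoms (m i). dist x x0 < e"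
proof -
  have m0: "m0 \<in> counting_measures" using lim by (simp add: vague_limit_def)
  have nz: "x0 \<noteq> 0" using atom_nonzero[OF m0 x0] .
  define d where "d = min e (norm x0 / 2)"
  have d: "0 < d" "d \<le> e" "norm x0 / 2 + d \<le> norm x0" using e nz by (auto simp: d_def)
  have f: "bump {x0} d \<in> test_functions euclidean away_from_zero"
    by (rule bump_test_function[of _ _ "norm x0 / 2"]) (use d nz in auto)
  have "1 \<le> (\<integral>x. bump {x0} d x \<partial>m0)"
    by (rule integral_ge_1_if_atom[OF m0 f bump_nonneg x0]) (simp add: bump_eq_1)
  moreover have "((\<lambda>i. \<integral>x. bump {x0} d x \<partial>m i) \<longlongrightarrow> (\<integral>x. bump {x0} d x \<partial>m0)) F"
    using lim f by (simp add: vague_limit_def)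
  ultimately have pos: "\<forall>\<^sub>F i in F. 0 < (\<integral>x. bump {x0} d x \<partial>m i)"
    by (intro order_tendstoD(1)[of _ "\<integral>x. bump {x0} d x \<partial>m0"]) auto
  have "\<forall>\<^sub>F i in F. m i \<in> counting_measures" using lim by (simp add: vague_limit_def)
  with pos show ?thesis
  proof eventually_elim
    case (elim i)
    then obtain x where x: "x \<in> atoms (m i)" "bump {x0} d x \<noteq> 0"
      using integral_eq_0_if_null_on_atoms[OF _ f, of "m i"] by fastforce
    then have "infdist x {x0} < d" using bump_eq_0_iff[OF d(1), of "{x0}" x] by linarith
    then show ?case using x(1) d(2) by (intro bexI[of _ x]) auto
  qed
qed

text \<open>
  Only finitely many atoms of the limit lie near \<open>C\<close>, so some bump function of \<open>C\<close> avoids them all;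
  its limiting integral is \<open>0\<close>, whereas an atom in \<open>C\<close> would contribute at least \<open>1\<close>.
\<close>
lemma vague_limit_no_atoms:
  fixes m :: "'i \<Rightarrow> 'a::euclidean_space measure"
  assumes lim: "vague_limit m m0 F" and C: "closed C" "\<And>x. x \<in> C \<Longrightarrow> s \<le> norm x" and s: "0 < s"
    and no: "C \<inter> atoms m0 = {}"
  shows "\<forall>\<^sub>F i in F. C \<inter> atoms (m i) = {}"
proof (cases "C = {}")
  case False
  have m0: "m0 \<in> counting_measures" using lim by (simp add: vague_limit_def)
  define N where "N = {x \<in> atoms m0. s / 2 \<le> norm x}"
  define d where "d = Min (insert (s / 2) ((\<lambda>x. infdist x C) ` N))"
  have fin: "finite N" unfolding N_def using s by (intro finite_atoms_outside_ball[OF m0]) auto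
  have "0 < infdist x C" if "x \<in> N" for x
    using that no in_closed_iff_infdist_zero[OF C(1) False, of x] infdist_nonneg[of x C]
    by (auto simp: N_def)
  then have d: "0 < d" using fin s unfolding d_def by (subst Min_gr_iff) auto
  have dN: "d \<le> infdist x C" if "x \<in> N" for x
    using fin that unfolding d_def by (intro Min_le) auto
  have d2: "d \<le> s / 2" using fin unfolding d_def by (intro Min_le) auto
  have Cd: "s / 2 + d \<le> norm x" if "x \<in> C" for x using C(2)[OF that] d2 by simp
  have "0 < s / 2" using s by simp
  note f = bump_test_function(1)[OF False d Cd this] and far = bump_test_function(2)[OF False d Cd this]
  have "(\<integral>x. bump C d x \<partial>m0) = 0"
  proof (rule integral_eq_0_if_null_on_atoms[OF m0 f])
    fix x assume x: "x \<in> atoms m0"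
    show "bump C d x = 0"
    proof (rule ccontr)
      assume nz: "bump C d x \<noteq> 0"
      then have "x \<in> N" using far x by (simp add: N_def)
      then show False using dN nz bump_eq_0_iff[OF d] by blast
    qed
  qed
  moreover have "((\<lambda>i. \<integral>x. bump C d x \<partial>m i) \<longlongrightarrow> (\<integral>x. bump C d x \<partial>m0)) F"
    using lim f by (simp add: vague_limit_def)
  ultimately have less: "\<forall>\<^sub>F i in F. (\<integral>x. bump C d x \<partial>m i) < 1"
    by (intro order_tendstoD(2)[of _ "\<integral>x. bump C d x \<partial>m0"]) auto
  have "\<forall>\<^sub>F i in F. m i \<in> counting_measures" using lim by (simp add: vague_limit_def)
  with less show ?thesis
  proof eventually_elim
    case (elim i)
    show ?case
    proof (rule ccontr)
      assume "C \<inter> atoms (m i) \<noteq> {}"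
      then obtain x where x: "x \<in> C" "x \<in> atoms (m i)" by blast
      have "1 \<le> (\<integral>x. bump C d x \<partial>m i)"
        by (rule integral_ge_1_if_atom[OF elim(2) f bump_nonneg x(2)]) (use x bump_eq_1 in auto)
      with elim(1) show False by simp
    qed
  qed
qed simp

lemma vague_limit_atoms_near_limit:
  fixes m :: "'i \<Rightarrow> 'a::euclidean_space measure"
  assumes lim: "vague_limit m m0 F" and s: "0 < s" and e: "0 < e"
  shows "\<forall>\<^sub>F i in F. \<forall>x\<in>atoms (m i). s \<le> norm x \<longrightarrow> (\<exists>y\<in>atoms m0. dist y x < e)"
proof -
  let ?C = "{x. s \<le> norm x} - (\<Union>y\<in>atoms m0. ball y e)"
  have "\<forall>\<^sub>F i in F. ?C \<inter> atoms (m i) = {}"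
  proof (rule vague_limit_no_atoms[OF lim _ _ s])
    have "closed {x::'a. s \<le> norm x}" by (intro closed_Collect_le continuous_intros)
    then show "closed ?C" by (intro closed_Diff open_UN) auto
    show "?C \<inter> atoms m0 = {}" using e by auto
  qed auto
  then show ?thesis by (rule eventually_mono) auto
qed

section \<open>The support map is continuous on its closed domain\<close>

lemma dist_zero_le: "x \<in> atoms m \<Longrightarrow> dist_zero m \<le> ennreal (norm x)"
  unfolding dist_zero_def by (rule INF_lower)

lemma dist_zero_lessE:
  assumes "dist_zero m < r"
  obtains x where "x \<in> atoms m" "ennreal (norm x) < r"
  using assms by (auto simp: dist_zero_def INF_less_iff)

lemma dist_zero_infinite_iff: "dist_zero m = \<infinity> \<longleftrightarrow> atoms m = {}"
  by (auto simp: dist_zero_def INF_top_conv)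

text \<open>
  The separate pair \<open>(0, \<infinity>)\<close> also has the form \<open>(m, d(0, m))\<close>, as \<open>d(0, m) = \<infinity>\<close> characterises the null measure.
\<close>
lemma support_domain_iff:
  "(m, r) \<in> support_domain \<longleftrightarrow> m \<in> counting_measures \<and> (r = dist_zero m \<or> r = 0)"
  using counting_measure_null_iff_no_atoms[of m] dist_zero_infinite_iff[of m] null_measure_counting
  by (auto simp: support_domain_def less_top)

lemma support_domain_subset: "support_domain \<subseteq> topspace marked_topology"
  by (auto simp: support_domain_iff)

lemma support_map_eq:
  assumes "m \<in> counting_measures"
  shows "support_map (m, r) = closure (atoms m \<union> (if r = 0 then {0} else {}))"
  using counting_measure_null_iff_no_atoms[OF assms]
  by (auto simp: support_map_def closure_Un zero_less_iff_neq_zero)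

lemma compact_support_map:
  assumes "m \<in> counting_measures"
  shows "compact (support_map (m, r))"
  unfolding support_map_eq[OF assms] closure_Un
  using compact_closure_atoms[OF assms] by (intro compact_Un) auto

text \<open>At distance \<open>0\<close> the atoms accumulate at the origin, so adding it to the closure changes nothing.\<close>
lemma support_map_dist_zero:
  assumes m: "m \<in> counting_measures"
  shows "support_map (m, dist_zero m) = closure (atoms m)"
proof -
  have "0 \<in> closure (atoms m)" if "dist_zero m = 0"
    unfolding closure_approachable
  proof (intro allI impI)
    fix e :: real assume "0 < e"
    then have "dist_zero m < ennreal e" using that by simp
    then show "\<exists>y\<in>atoms m. dist y 0 < e"
      by (auto elim!: dist_zero_lessE simp: ennreal_less_iff)
  qed
  then show ?thesis
    unfolding support_map_eq[OF m] closure_Un by (auto simp: insert_absorb)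
qed

lemma ennreal_dense_real:
  assumes "(x::ennreal) < y"
  obtains c where "0 \<le> c" "x < ennreal c" "ennreal c < y"
proof -
  obtain z where z: "x < z" "z < y" using dense[OF assms] by blast
  then show ?thesis using that by (cases z) auto
qed

text \<open>
  Near \<open>(m, r)\<close> with \<open>r > d(0, m)\<close> an atom of the measures stays at norm below the marks; with
  \<open>0 < r < d(0, m)\<close> a whole shell around radius \<open>r\<close> stays free of atoms.
\<close>
lemma closedin_support_domain:
  "closedin marked_topology (support_domain :: ('a::euclidean_space measure \<times> ennreal) set)"
proof -
  let ?X = "marked_topology :: ('a measure \<times> ennreal) topology"
  have "openin ?X (topspace ?X - support_domain)"
  proof (subst openin_iff_eventually_nhdsin, blast, intro ballI)
    fix p assume p: "p \<in> topspace ?X - support_domain"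
    obtain m0 r0 where p_eq: "p = (m0, r0)" by (cases p)
    have r0: "r0 \<noteq> 0" "r0 \<noteq> dist_zero m0" using p by (auto simp: p_eq support_domain_iff)
    let ?F = "nhdsin ?X p"
    have lim: "vague_limit fst m0 ?F" and mark: "(snd \<longlongrightarrow> r0) ?F"
      and top: "\<forall>\<^sub>F q in ?F. q \<in> topspace ?X"
      using marked_limits[OF order_refl, of p] p unfolding subtopology_topspace by (simp_all add: p_eq)
    have "\<forall>\<^sub>F q in ?F. snd q \<noteq> 0 \<and> snd q \<noteq> dist_zero (fst q)"
    proof (cases "dist_zero m0 < r0")
      case True
      then obtain x0 where x0: "x0 \<in> atoms m0" "ennreal (norm x0) < r0" by (rule dist_zero_lessE)
      from x0(2) obtain c where "ennreal (norm x0) < ennreal c" and c: "0 \<le> c" "ennreal c < r0"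
        by (rule ennreal_dense_real)
      then have c0: "norm x0 < c" by (simp add: ennreal_less_iff)
      have "\<forall>\<^sub>F q in ?F. \<exists>x\<in>atoms (fst q). dist x x0 < c - norm x0"
        using c0 by (intro vague_limit_atom_near[OF lim x0(1)]) auto
      moreover have "\<forall>\<^sub>F q in ?F. ennreal c < snd q" using mark c(2) by (rule order_tendstoD)
      ultimately show ?thesis
      proof eventually_elim
        case (elim q)
        then obtain x where x: "x \<in> atoms (fst q)" "dist x x0 < c - norm x0" by blast
        then have "norm x \<le> c" using norm_triangle_ineq2[of x x0] by (simp add: dist_norm)
        then have "dist_zero (fst q) \<le> ennreal c"
          using dist_zero_le[OF x(1)] by (meson ennreal_leI order_trans)
        with elim(2) show ?case by auto
      qed
    next
      case False
      with r0 have "0 < r0" "r0 < dist_zero m0" by (auto simp: zero_less_iff_neq_zero)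
      then obtain a b where ab: "0 < a" "ennreal a < r0" "r0 < ennreal b" "ennreal b < dist_zero m0"
        by (metis ennreal_dense_real ennreal_less_zero_iff)
      let ?C = "{x::'a. a \<le> norm x \<and> norm x \<le> b}"
      have "\<forall>\<^sub>F q in ?F. ?C \<inter> atoms (fst q) = {}"
      proof (rule vague_limit_no_atoms[OF lim _ _ ab(1)])
        show "closed ?C"
          by (intro closed_Collect_conj closed_Collect_le continuous_intros)
        have False if "x \<in> ?C" "x \<in> atoms m0" for x
        proof -
          have "dist_zero m0 \<le> ennreal (norm x)" using that by (intro dist_zero_le)
          also have "\<dots> \<le> ennreal b" using that by (intro ennreal_leI) simp
          finally show False using ab(4) by simp
        qed
        then show "?C \<inter> atoms m0 = {}" by blast
      qed auto
      moreover have "\<forall>\<^sub>F q in ?F. ennreal a < snd q" using mark ab(2) by (rule order_tendstoD)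
      moreover have "\<forall>\<^sub>F q in ?F. snd q < ennreal b" using mark ab(3) by (rule order_tendstoD)
      ultimately show ?thesis
      proof eventually_elim
        case (elim q)
        have "snd q \<noteq> dist_zero (fst q)"
        proof
          assume eq: "snd q = dist_zero (fst q)"
          with elim(3) obtain x where x: "x \<in> atoms (fst q)" "ennreal (norm x) < ennreal b"
            by (metis dist_zero_lessE)
          have "ennreal a < ennreal (norm x)"
            using elim(2) dist_zero_le[OF x(1)] eq by (metis order_less_le_trans)
          then have "x \<in> ?C" using x(2) ab(1) by (simp add: ennreal_less_iff)
          then show False using elim(1) x(1) by blast
        qed
        with elim(2) show ?case by auto
      qed
    qed
    with top show "\<forall>\<^sub>F q in ?F. q \<in> topspace ?X - support_domain"
      by eventually_elim (auto simp: support_domain_iff)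
  qed
  then show ?thesis using support_domain_subset by (simp add: closedin_def)
qed

lemma closure_cover:
  fixes A B :: "'a::metric_space set"
  assumes "A \<subseteq> (\<Union>x\<in>B. cball x (e/2))" "0 < e"
  shows "closure A \<subseteq> (\<Union>x\<in>closure B. cball x e)"
proof
  fix y assume "y \<in> closure A"
  then obtain a where a: "a \<in> A" "dist a y < e/2"
    using assms(2) unfolding closure_approachable by (meson half_gt_zero)
  then obtain x where x: "x \<in> B" "dist x a \<le> e/2" using assms(1) by auto
  have "dist x y \<le> e" using a x dist_triangle[of x y a] by linarith
  then show "y \<in> (\<Union>x\<in>closure B. cball x e)" using x closure_subset[of B] by auto
qed

text \<open>
  The mark decides whether the origin belongs to the limit. If it stays away from \<open>0\<close> it is the
  distance of all atoms to the origin, so that all atoms stay in a region where vague convergence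
  controls them. If it tends to \<open>0\<close>, the origin is in the limit and can absorb all small atoms.
\<close>
lemma continuous_map_support_map:
  "continuous_map (subtopology marked_topology (support_domain :: ('a::euclidean_space measure \<times> ennreal) set))
     hausdorff_topology support_map"
proof (rule continuous_map_hausdorff_topologyI)
  fix p :: "'a measure \<times> ennreal"
  assume "p \<in> topspace (subtopology marked_topology support_domain)"
  then have p: "p \<in> support_domain" by auto
  obtain m0 r0 where p_eq: "p = (m0, r0)" by (cases p)
  have m0: "m0 \<in> counting_measures" and r0: "r0 = dist_zero m0 \<or> r0 = 0"
    using p by (auto simp: p_eq support_domain_iff)
  show "compact (support_map p)" unfolding p_eq by (rule compact_support_map[OF m0])
  fix e' :: real assume e': "0 < e'"
  define e where "e = e'/2"
  have e: "0 < e" using e' by (simp add: e_def)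
  define S :: "'a measure \<times> ennreal \<Rightarrow> 'a set"
    where "S q = atoms (fst q) \<union> (if snd q = 0 then {0} else {})" for q
  let ?F = "nhdsin (subtopology marked_topology support_domain) p"
  have lim: "vague_limit fst m0 ?F" and mark: "(snd \<longlongrightarrow> r0) ?F"
    and dom: "\<forall>\<^sub>F q in ?F. q \<in> support_domain"
    using marked_limits[OF support_domain_subset p] by (simp_all add: p_eq)
  have near: "\<forall>\<^sub>F q in ?F. \<forall>x\<in>{x \<in> atoms m0. s \<le> norm x}. \<exists>y\<in>atoms (fst q). dist y x < e"
    if "0 < s" for s
    using vague_limit_atom_near[OF lim _ e]
    by (intro eventually_ball_finite finite_atoms_outside_ball[OF m0 that]) auto
  have "\<forall>\<^sub>F q in ?F. S p \<subseteq> (\<Union>x\<in>S q. cball x e) \<and> S q \<subseteq> (\<Union>x\<in>S p. cball x e)"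
  proof (cases "r0 = 0")
    case True
    have "0 < e/2" using e by simp
    have "\<forall>\<^sub>F q in ?F. snd q < ennreal (e/2)"
      using mark e True by (intro order_tendstoD(2)) auto
    with near[OF \<open>0 < e/2\<close>] vague_limit_atoms_near_limit[OF lim e e] dom show ?thesis
    proof eventually_elim
      case (elim q)
      obtain m r where q: "q = (m, r)" by (cases q)
      have "\<exists>z\<in>S q. norm z < e/2"
      proof (cases "r = 0")
        case True
        then show ?thesis using e by (auto simp: S_def q)
      next
        case False
        then have "dist_zero m < ennreal (e/2)" using elim by (auto simp: q support_domain_iff)
        then show ?thesis by (auto elim!: dist_zero_lessE simp: S_def q ennreal_less_iff)
      qed
      then obtain z where z: "z \<in> S q" "norm z < e/2" by blast
      have "\<exists>y\<in>S q. dist y x \<le> e" if "x \<in> S p" for x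
      proof (cases "x \<in> atoms m0 \<and> e/2 \<le> norm x")
        case True
        then obtain y where "y \<in> atoms (fst q)" "dist y x < e" using elim(1) by blast
        then show ?thesis by (intro bexI[of _ y]) (auto simp: S_def)
      next
        case False
        then have "norm x \<le> e/2" using that e by (auto simp: S_def p_eq split: if_splits)
        then have "dist z x \<le> e" using z(2) norm_triangle_ineq4[of z x] by (simp add: dist_norm)
        then show ?thesis using z(1) by blast
      qed
      moreover have "\<exists>y\<in>S p. dist y x \<le> e" if "x \<in> S q" for x
      proof (cases "x \<in> atoms (fst q) \<and> e \<le> norm x")
        case True
        then obtain y where "y \<in> atoms m0" "dist y x < e" using elim(2) by blast
        then show ?thesis by (intro bexI[of _ y]) (auto simp: S_def p_eq)
      next
        case False
        then have "norm x \<le> e" using that e by (auto simp: S_def split: if_splits)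
        then show ?thesis using True by (intro bexI[of _ 0]) (auto simp: S_def p_eq)
      qed
      ultimately show ?case by (auto simp: subset_iff)
    qed
  next
    case False
    then have r0: "r0 = dist_zero m0" and "0 < r0" using r0 by (auto simp: zero_less_iff_neq_zero)
    then obtain s where s: "0 < s" "ennreal s < r0"
      by (metis ennreal_dense_real ennreal_less_zero_iff)
    have "\<forall>\<^sub>F q in ?F. ennreal s < snd q" using mark s(2) by (rule order_tendstoD)
    with near[OF s(1)] vague_limit_atoms_near_limit[OF lim s(1) e] dom show ?thesis
    proof eventually_elim
      case (elim q)
      have far: "s \<le> norm x" if "x \<in> atoms m" "ennreal s < dist_zero m" for m and x :: 'a
      proof -
        have "ennreal s < ennreal (norm x)" using that dist_zero_le order_less_le_trans by blast
        then show ?thesis using s(1) by (simp add: ennreal_less_iff)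
      qed
      have "snd q \<noteq> 0" using elim(4) by auto
      then have "snd q = dist_zero (fst q)" using elim(3) by (cases q) (auto simp: support_domain_iff)
      then have "ennreal s < dist_zero (fst q)" using elim(4) by simp
      moreover have "S q = atoms (fst q)" "S p = atoms m0"
        using \<open>snd q \<noteq> 0\<close> False by (auto simp: S_def p_eq)
      moreover have "ennreal s < dist_zero m0" using s r0 by simp
      ultimately show ?case using elim(1,2) far by (fastforce intro: less_imp_le)
    qed
  qed
  with dom show "\<forall>\<^sub>F q in ?F. support_map p \<subseteq> (\<Union>z\<in>support_map q. cball z e') \<and>
      support_map q \<subseteq> (\<Union>z\<in>support_map p. cball z e')"
  proof eventually_elim
    case (elim q)
    have eq: "support_map q = closure (S q)" if "q \<in> support_domain" for q
      using that support_map_eq[of "fst q" "snd q"] by (cases q) (auto simp: support_domain_iff S_def)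
    show ?case
      using elim(2) closure_cover[OF _ e'] unfolding eq[OF p] eq[OF elim(1)] e_def by blast
  qed
qed

lemma atoms_scale_measure_by:
  fixes m :: "'a::euclidean_space measure"
  assumes m: "m \<in> counting_measures" and t: "0 < t"
  shows "atoms (scale_measure_by t m) = (\<lambda>x. t *\<^sub>R x) ` atoms m"
proof -
  have meas: "(\<lambda>x::'a. t *\<^sub>R x) \<in> m \<rightarrow>\<^sub>M punctured"
    unfolding punctured_def
  proof (rule measurable_restrict_space2)
    have "(\<lambda>x::'a. t *\<^sub>R x) \<in> restrict_space borel (- {0}) \<rightarrow>\<^sub>M borel"
      by (intro measurable_restrict_space1) simp
    then show "(\<lambda>x. t *\<^sub>R x) \<in> m \<rightarrow>\<^sub>M borel"
      using m by (subst measurable_cong_sets[of m punctured borel borel])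
        (auto simp: counting_measures_def punctured_def)
    show "(\<lambda>x. t *\<^sub>R x) \<in> space m \<rightarrow> - {0}" using t counting_measuresD(1)[OF m] by auto
  qed
  have eq: "emeasure (scale_measure_by t m) {y} = emeasure m {y /\<^sub>R t}" if y: "y \<noteq> 0" for y
  proof -
    have "t *\<^sub>R x = y \<longleftrightarrow> x = y /\<^sub>R t" for x
    proof
      assume "t *\<^sub>R x = y"
      then have "y /\<^sub>R t = (inverse t * t) *\<^sub>R x" by (simp flip: scaleR_scaleR)
      then show "x = y /\<^sub>R t" using t by simp
    qed (use t in simp)
    then have "(\<lambda>x. t *\<^sub>R x) -` {y} \<inter> space m = {y /\<^sub>R t}"
      using t y counting_measuresD(1)[OF m] by (simp add: vimage_def set_eq_iff)
    then show ?thesis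
      unfolding scale_measure_by_def using y
      by (subst emeasure_distr[OF meas]) (auto simp: sets_punctured)
  qed
  have zero: "0 \<notin> atoms (scale_measure_by t m)"
    unfolding atoms_def scale_measure_by_def
    by (simp add: emeasure_notin_sets sets_punctured)
  show ?thesis
  proof (intro set_eqI iffI)
    fix y assume y: "y \<in> atoms (scale_measure_by t m)"
    then have "y \<noteq> 0" using zero by auto
    then have "y /\<^sub>R t \<in> atoms m" using y eq by (simp add: atoms_def)
    moreover have "y = t *\<^sub>R (y /\<^sub>R t)" using t by simp
    ultimately show "y \<in> (\<lambda>x. t *\<^sub>R x) ` atoms m" by blast
  next
    fix y assume "y \<in> (\<lambda>x. t *\<^sub>R x) ` atoms m"
    then obtain x where x: "x \<in> atoms m" "y = t *\<^sub>R x" by blast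
    then show "y \<in> atoms (scale_measure_by t m)"
      using eq[of y] atom_nonzero[OF m x(1)] t by (simp add: atoms_def)
  qed
qed

lemma dist_zero_scale_measure_by:
  fixes m :: "'a::euclidean_space measure"
  assumes m: "m \<in> counting_measures" and t: "0 < t"
  shows "dist_zero (scale_measure_by t m) = ennreal t * dist_zero m"
proof -
  have low: "ennreal s * (INF x\<in>A. ennreal (norm x)) \<le> (INF x\<in>(\<lambda>x. s *\<^sub>R x) ` A. ennreal (norm x))"
    if "0 < s" for s and A :: "'a set"
  proof (rule INF_greatest)
    fix y assume "y \<in> (\<lambda>x. s *\<^sub>R x) ` A"
    then obtain x where x: "x \<in> A" "y = s *\<^sub>R x" by blast
    have "ennreal s * (INF x\<in>A. ennreal (norm x)) \<le> ennreal s * ennreal (norm x)"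
      using x by (intro mult_left_mono INF_lower) auto
    also have "\<dots> = ennreal (norm y)" using x that by (simp add: ennreal_mult')
    finally show "ennreal s * (INF x\<in>A. ennreal (norm x)) \<le> ennreal (norm y)" .
  qed
  let ?A = "(\<lambda>x. t *\<^sub>R x) ` atoms m" and ?D = "\<lambda>A::'a set. INF x\<in>A. ennreal (norm x)"
  have "ennreal (inverse t) * ?D ?A \<le> ?D ((\<lambda>x. inverse t *\<^sub>R x) ` ?A)"
    using t by (intro low) auto
  also have "(\<lambda>x. inverse t *\<^sub>R x) ` ?A = atoms m" using t by (simp add: image_image)
  finally have "ennreal t * (ennreal (inverse t) * ?D ?A) \<le> ennreal t * ?D (atoms m)"
    by (intro mult_left_mono) auto
  moreover have "ennreal t * (ennreal (inverse t) * ?D ?A) = ?D ?A"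
    using t by (simp flip: mult.assoc ennreal_mult)
  ultimately have "?D ?A \<le> ennreal t * ?D (atoms m)" by simp
  with low[OF t, of "atoms m"] show ?thesis
    unfolding dist_zero_def atoms_scale_measure_by[OF m t] by (rule antisym[rotated])
qed

section \<open>Regular variation under maps that are continuous on a closed set\<close>

text \<open>
  The scaled random elements stay in \<open>S\<close>, so test functions vanishing on \<open>S\<close> have limit \<open>0\<close>. The open
  complement of \<open>S\<close> is a countable union of closed sets, each detected by such a test function.
\<close>
lemma tail_measure_concentrated:
  assumes lim: "tail_limit P X T I g \<mu> \<xi>"
    and S: "closedin X S" "\<And>t \<omega>. 0 < t \<Longrightarrow> \<omega> \<in> space P \<Longrightarrow> T t (\<xi> \<omega>) \<in> S"
    and \<phi>: "continuous_map X euclideanreal \<phi>" "\<And>x. 0 \<le> \<phi> x" "\<And>x. \<phi> x \<le> 1"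
    and A: "closedin X A" "A \<in> I" "\<And>x. \<phi> x \<noteq> 0 \<Longrightarrow> x \<in> A"
  shows "AE x in \<mu>. \<phi> x \<noteq> 0 \<longrightarrow> x \<in> S"
proof -
  have met: "metrizable_space X" and I: "ideal_on (topspace X) I"
    and sets: "sets \<mu> = sets (borel_of X)"
    and fin: "\<And>B. B \<in> sets \<mu> \<Longrightarrow> B \<in> I \<Longrightarrow> emeasure \<mu> B < \<infinity>"
    and conv: "\<And>f. f \<in> test_functions X I \<Longrightarrow>
      ((\<lambda>t. g t * (\<integral>\<omega>. f (T (inverse t) (\<xi> \<omega>)) \<partial>P)) \<longlongrightarrow> (\<integral>x. f x \<partial>\<mu>)) at_top"
    using lim by (auto simp: tail_limit_def)
  have space: "space \<mu> = topspace X" using sets_eq_imp_space_eq[OF sets] by simp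
  have A\<mu>: "A \<in> sets \<mu>" unfolding sets using A(1) by (rule closedin_sets_borel_of)
  have AX: "A \<subseteq> topspace X" using A(1) by (rule closedin_subset)
  have null: "AE x in \<mu>. \<phi> x * w x = 0"
    if w: "continuous_map X euclideanreal w" "\<And>x. x \<in> topspace X \<Longrightarrow> 0 \<le> w x \<and> w x \<le> 1"
      "\<And>x. x \<in> S \<Longrightarrow> w x = 0" for w
  proof -
    have le1: "0 \<le> \<phi> x * w x" "\<bar>\<phi> x * w x\<bar> \<le> 1" if "x \<in> topspace X" for x
      using \<phi>(2,3)[of x] w(2)[OF that] by (auto intro: mult_le_one)
    have b: "\<bar>\<phi> x * w x\<bar> \<le> 1" for x
    proof (cases "x \<in> topspace X")
      case False
      then have "\<phi> x = 0" using A(3)[of x] AX by blast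
      then show ?thesis by simp
    qed (rule le1(2))
    have cont: "continuous_map X euclideanreal (\<lambda>x. \<phi> x * w x)"
      using \<phi>(1) w(1) by (rule continuous_map_real_mult)
    have test: "(\<lambda>x. \<phi> x * w x) \<in> test_functions X I"
      by (rule test_functionsI[OF cont _ A(2) I A(1)])
        (use b A(3) in \<open>auto simp: bounded_iff\<close>)
    have "\<forall>\<^sub>F t in at_top. g t * (\<integral>\<omega>. \<phi> (T (inverse t) (\<xi> \<omega>)) * w (T (inverse t) (\<xi> \<omega>)) \<partial>P) = 0"
      using eventually_gt_at_top[of "0::real"]
    proof eventually_elim
      case (elim t)
      have "(\<integral>\<omega>. \<phi> (T (inverse t) (\<xi> \<omega>)) * w (T (inverse t) (\<xi> \<omega>)) \<partial>P) = (\<integral>\<omega>. 0 \<partial>P)"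
        using elim S(2)[of "inverse t"] w(3) by (intro Bochner_Integration.integral_cong) auto
      then show ?case by simp
    qed
    then have "((\<lambda>t. g t * (\<integral>\<omega>. \<phi> (T (inverse t) (\<xi> \<omega>)) * w (T (inverse t) (\<xi> \<omega>)) \<partial>P)) \<longlongrightarrow> 0) at_top"
      by (rule tendsto_eventually)
    with conv[OF test] have zero: "(\<integral>x. \<phi> x * w x \<partial>\<mu>) = 0"
      by (intro tendsto_unique[OF trivial_limit_at_top_linorder])
    have meas: "(\<lambda>x. \<phi> x * w x) \<in> borel_measurable \<mu>"
      using continuous_map_borel_measurable[OF cont] measurable_cong_sets[OF sets refl] by blast
    have "integrable \<mu> (\<lambda>x. \<phi> x * w x)"
    proof (rule integrableI_bounded_set[OF A\<mu> meas])
      show "emeasure \<mu> A < \<infinity>" using fin A\<mu> A(2) by blast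
    qed (use b A(3) in auto)
    moreover have "AE x in \<mu>. 0 \<le> \<phi> x * w x" using le1(1) by (intro AE_I2) (simp add: space)
    ultimately show ?thesis using zero integral_nonneg_eq_0_iff_AE by blast
  qed
  have "fsigma_in X (topspace X - S)"
    using met S(1) by (intro open_imp_fsigma_in) auto
  then obtain C :: "nat \<Rightarrow> _" where C: "\<And>n. closedin X (C n)" "\<Union>(range C) = topspace X - S"
    unfolding fsigma_in_ascending by blast
  have "\<exists>w. continuous_map X euclideanreal w \<and> (\<forall>x\<in>topspace X. 0 \<le> w x \<and> w x \<le> 1) \<and>
      (\<forall>x\<in>S. w x = 0) \<and> (\<forall>x\<in>C n. w x = 1)" for n
  proof -
    have "disjnt S (C n)" using C(2) by (auto simp: disjnt_def)
    from Urysohn_lemma[OF metrizable_imp_normal_space[OF met] S(1) C(1)[of n] this, of 0 1]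
    obtain w :: "'b \<Rightarrow> real" where "continuous_map X (top_of_set {0..1}) w"
        "w ` S \<subseteq> {0}" "w ` C n \<subseteq> {1}" by auto
    then show ?thesis
      by (intro exI[of _ w]) (auto simp: continuous_map_in_subtopology)
  qed
  then obtain w where w: "\<And>n. continuous_map X euclideanreal (w n)"
    "\<And>n x. x \<in> topspace X \<Longrightarrow> 0 \<le> w n x \<and> w n x \<le> (1::real)"
    "\<And>n x. x \<in> S \<Longrightarrow> w n x = 0" "\<And>n x. x \<in> C n \<Longrightarrow> w n x = 1" by metis
  have "AE x in \<mu>. \<forall>n. \<phi> x * w n x = 0"
    unfolding AE_all_countable using null[OF w(1-3)] by blast
  then show ?thesis
  proof (rule AE_mp, intro AE_I2 impI)
    fix x assume x: "x \<in> space \<mu>" "\<forall>n. \<phi> x * w n x = 0" "\<phi> x \<noteq> 0"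
    show "x \<in> S"
    proof (rule ccontr)
      assume "x \<notin> S"
      then obtain n where "x \<in> C n" using x(1) C(2) space by blast
      then show False using x(2,3) w(4) by (metis mult_cancel_left1 mult_eq_0_iff)
    qed
  qed
qed

text \<open>
  A test function on the target, composed with \<open>\<psi>\<close>, is only defined on \<open>S\<close>. A Tietze extension
  multiplied by a cut-off is a test function on the source which agrees with the composition on \<open>S\<close>,
  where both the scaled random elements and the tail measure live.
\<close>
lemma tail_limit_pushforward:
  assumes lim: "tail_limit P X T I g \<mu> \<xi>"
    and Y: "metrizable_space Y" "scaling_on Y T'" "ideal_on (topspace Y) J" "openin Y (\<Union>J)"
    and S: "closedin X S" "\<And>t \<omega>. 0 < t \<Longrightarrow> \<omega> \<in> space P \<Longrightarrow> T t (\<xi> \<omega>) \<in> S"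
    and \<psi>: "continuous_map (subtopology X S) Y \<psi>"
    and \<zeta>: "\<And>\<omega>. \<omega> \<in> space P \<Longrightarrow> \<zeta> \<omega> = \<psi> (\<xi> \<omega>)"
      "\<And>t \<omega>. 0 < t \<Longrightarrow> \<omega> \<in> space P \<Longrightarrow> \<psi> (T t (\<xi> \<omega>)) = T' t (\<zeta> \<omega>)"
    and cutoff: "\<And>B. B \<in> J \<Longrightarrow> \<exists>\<phi> A. continuous_map X euclideanreal \<phi> \<and>
      (\<forall>x. 0 \<le> \<phi> x \<and> \<phi> x \<le> 1) \<and> closedin X A \<and> A \<in> I \<and> (\<forall>x. \<phi> x \<noteq> 0 \<longrightarrow> x \<in> A) \<and>
      (\<forall>x\<in>S. \<psi> x \<in> B \<longrightarrow> \<phi> x = 1)"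
  shows "tail_limit P Y T' J g (tail_pushforward \<mu> S \<psi> Y J) \<zeta>"
proof -
  let ?\<nu> = "tail_pushforward \<mu> S \<psi> Y J"
  have met: "metrizable_space X" and I: "ideal_on (topspace X) I" and scal: "scaling_on X T"
    and P: "prob_space P" and \<xi>: "\<xi> \<in> P \<rightarrow>\<^sub>M borel_of X"
    and g: "g \<in> borel_measurable (restrict_space borel {0..})" "\<forall>t\<ge>0. g t \<ge> 0"
      "filterlim g at_top at_top"
    and sets: "sets \<mu> = sets (borel_of X)"
    and fin: "\<And>B. B \<in> sets \<mu> \<Longrightarrow> B \<in> I \<Longrightarrow> emeasure \<mu> B < \<infinity>"
    and conv: "\<And>f. f \<in> test_functions X I \<Longrightarrow>
      ((\<lambda>t. g t * (\<integral>\<omega>. f (T (inverse t) (\<xi> \<omega>)) \<partial>P)) \<longlongrightarrow> (\<integral>x. f x \<partial>\<mu>)) at_top"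
    using lim by (auto simp: tail_limit_def)
  have space: "space \<mu> = topspace X" using sets_eq_imp_space_eq[OF sets] by simp
  have SX: "S \<subseteq> topspace X" using S(1) by (rule closedin_subset)
  have S\<mu>: "S \<in> sets \<mu>" unfolding sets using S(1) by (rule closedin_sets_borel_of)
  have \<xi>S: "\<xi> \<omega> \<in> S" if "\<omega> \<in> space P" for \<omega>
    using S(2)[of 1 \<omega>] scal measurable_space[OF \<xi> that] that by (simp add: scaling_on_def)
  have \<psi>Y: "\<psi> x \<in> topspace Y" if "x \<in> S" for x
    using continuous_map_funspace[OF \<psi>] SX that by auto
  have restr: "sets (restrict_space \<mu> S) = sets (restrict_space (borel_of X) S)"
    using sets by (rule sets_restrict_space_cong)
  have \<psi>meas0: "\<psi> \<in> restrict_space (borel_of X) S \<rightarrow>\<^sub>M borel_of Y"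
    using \<psi> S\<mu> sets by (intro continuous_map_measurable_restrict) auto
  then have \<psi>meas: "\<psi> \<in> restrict_space \<mu> S \<rightarrow>\<^sub>M borel_of Y"
    using measurable_cong_sets[OF restr refl] by blast
  have "(\<lambda>\<omega>. \<psi> (\<xi> \<omega>)) \<in> P \<rightarrow>\<^sub>M borel_of Y"
    using \<xi> \<xi>S by (intro measurable_compose[OF _ \<psi>meas0] measurable_restrict_space2) auto
  then have \<zeta>meas: "\<zeta> \<in> P \<rightarrow>\<^sub>M borel_of Y"
    using measurable_cong[of P \<zeta> "\<lambda>\<omega>. \<psi> (\<xi> \<omega>)" "borel_of Y"] \<zeta>(1) by simp
  have UJ: "\<Union>J \<in> sets (borel_of Y)" using Y(4) by (rule openin_sets_borel_of)
  have sets\<nu>: "sets ?\<nu> = sets (borel_of Y)" by (simp add: tail_pushforward_def)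
  have em: "emeasure ?\<nu> B = emeasure \<mu> {x \<in> S. \<psi> x \<in> B \<inter> \<Union>J}" if B: "B \<in> sets (borel_of Y)" for B
  proof -
    have "emeasure ?\<nu> B = (\<integral>\<^sup>+y. indicator (\<Union>J) y * indicator B y \<partial>distr (restrict_space \<mu> S) (borel_of Y) \<psi>)"
      unfolding tail_pushforward_def using UJ B by (intro emeasure_density) auto
    also have "\<dots> = (\<integral>\<^sup>+y. indicator (B \<inter> \<Union>J) y \<partial>distr (restrict_space \<mu> S) (borel_of Y) \<psi>)"
      by (intro nn_integral_cong) (auto simp: indicator_def)
    also have "\<dots> = emeasure (distr (restrict_space \<mu> S) (borel_of Y) \<psi>) (B \<inter> \<Union>J)"
      using UJ B by (intro nn_integral_indicator) auto
    also have "\<dots> = emeasure (restrict_space \<mu> S) (\<psi> -` (B \<inter> \<Union>J) \<inter> space (restrict_space \<mu> S))"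
      using UJ B by (intro emeasure_distr[OF \<psi>meas]) auto
    also have "\<psi> -` (B \<inter> \<Union>J) \<inter> space (restrict_space \<mu> S) = {x \<in> S. \<psi> x \<in> B \<inter> \<Union>J}"
      using SX by (auto simp: space_restrict_space space)
    also have "emeasure (restrict_space \<mu> S) {x \<in> S. \<psi> x \<in> B \<inter> \<Union>J} = emeasure \<mu> {x \<in> S. \<psi> x \<in> B \<inter> \<Union>J}"
      using S\<mu> SX by (intro emeasure_restrict_space) (auto simp: space inf_absorb1)
    finally show ?thesis .
  qed
  have fin\<nu>: "emeasure ?\<nu> B < \<infinity>" if B: "B \<in> sets ?\<nu>" "B \<in> J" for B
  proof -
    obtain \<phi> A where A: "closedin X A" "A \<in> I" "\<And>x. \<phi> x \<noteq> (0::real) \<Longrightarrow> x \<in> A"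
      "\<And>x. x \<in> S \<Longrightarrow> \<psi> x \<in> B \<Longrightarrow> \<phi> x = 1"
      using cutoff[OF B(2)] by blast
    have A\<mu>: "A \<in> sets \<mu>" unfolding sets using A(1) by (rule closedin_sets_borel_of)
    have "emeasure ?\<nu> B = emeasure \<mu> {x \<in> S. \<psi> x \<in> B \<inter> \<Union>J}" using B sets\<nu> by (intro em) auto
    also have "\<dots> \<le> emeasure \<mu> A" using A(3,4) A\<mu> by (intro emeasure_mono) force+
    also have "\<dots> < \<infinity>" using fin A\<mu> A(2) by blast
    finally show ?thesis .
  qed
  have null\<nu>: "emeasure ?\<nu> B = 0" if "B \<in> sets ?\<nu>" "B \<inter> \<Union>J = {}" for B
    using em[of B] that sets\<nu> by simp
  have "((\<lambda>t. g t * (\<integral>\<omega>. f (T' (inverse t) (\<zeta> \<omega>)) \<partial>P)) \<longlongrightarrow> (\<integral>y. f y \<partial>?\<nu>)) at_top"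
    if f: "f \<in> test_functions Y J" for f
  proof -
    let ?B = "Y closure_of {y. f y \<noteq> 0}"
    have BJ: "?B \<in> J" and f0: "\<And>y. y \<notin> \<Union>J \<Longrightarrow> f y = 0" and "bounded (range f)"
      using f by (auto simp: test_functions_def)
    then obtain b where b: "\<And>y. \<bar>f y\<bar> \<le> b" by (auto simp: bounded_iff)
    have b0: "0 \<le> b" using b[of undefined] by linarith
    have fY: "continuous_map Y euclideanreal f" using test_functions_continuous[OF Y(3,4) f] .
    have fB: "y \<in> ?B" if "y \<in> topspace Y" "f y \<noteq> 0" for y
      using closure_of_subset_Int[of Y "{y. f y \<noteq> 0}"] that by blast
    obtain \<phi> A where \<phi>: "continuous_map X euclideanreal \<phi>" "\<And>x. 0 \<le> \<phi> x" "\<And>x. \<phi> x \<le> 1"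
      and A: "closedin X A" "A \<in> I" "\<And>x. \<phi> x \<noteq> (0::real) \<Longrightarrow> x \<in> A"
      and \<phi>1: "\<And>x. x \<in> S \<Longrightarrow> \<psi> x \<in> ?B \<Longrightarrow> \<phi> x = 1"
      using cutoff[OF BJ] by blast
    have "continuous_map (subtopology X S) euclideanreal (\<lambda>x. f (\<psi> x))"
      using continuous_map_compose[OF \<psi> fY] by (simp add: o_def)
    moreover have "(\<lambda>x. f (\<psi> x)) ` S \<subseteq> {- b..b}" "- b \<le> b" using b b0 by (auto simp: abs_le_iff minus_le_iff)
    ultimately obtain h where h: "continuous_map X euclideanreal h" "\<And>x. x \<in> S \<Longrightarrow> h x = f (\<psi> x)"
        "h ` topspace X \<subseteq> {- b..b}"
      using Tietze_extension_closed_real_interval[OF metrizable_imp_normal_space[OF met] S(1)] by metis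
    define H where "H x = h x * \<phi> x" for x
    have HS: "H x = f (\<psi> x)" if "x \<in> S" for x
      using h(2)[OF that] \<phi>1[OF that] fB[OF \<psi>Y[OF that]] by (cases "f (\<psi> x) = 0") (auto simp: H_def)
    have Hc: "continuous_map X euclideanreal H"
      unfolding H_def using h(1) \<phi>(1) by (rule continuous_map_real_mult)
    have "\<bar>H x\<bar> \<le> b" for x
    proof (cases "\<phi> x = 0")
      case False
      then have "x \<in> topspace X" using A(1,3) closedin_subset by blast
      then have "\<bar>h x\<bar> \<le> b" using h(3) by (auto simp: abs_le_iff minus_le_iff)
      then have "\<bar>h x\<bar> * \<bar>\<phi> x\<bar> \<le> b * 1" using \<phi>(2,3)[of x] b0 by (intro mult_mono) auto
      then show ?thesis by (simp add: H_def abs_mult)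
    qed (use b0 in \<open>simp add: H_def\<close>)
    then have Htest: "H \<in> test_functions X I"
      by (intro test_functionsI[OF Hc _ A(2) I A(1)]) (use A(3) in \<open>auto simp: bounded_iff H_def\<close>)
    have "\<forall>\<^sub>F t in at_top. g t * (\<integral>\<omega>. H (T (inverse t) (\<xi> \<omega>)) \<partial>P)
        = g t * (\<integral>\<omega>. f (T' (inverse t) (\<zeta> \<omega>)) \<partial>P)"
      using eventually_gt_at_top[of "0::real"]
    proof eventually_elim
      case (elim t)
      have "(\<integral>\<omega>. H (T (inverse t) (\<xi> \<omega>)) \<partial>P) = (\<integral>\<omega>. f (T' (inverse t) (\<zeta> \<omega>)) \<partial>P)"
        using elim HS S(2)[of "inverse t"] \<zeta>(2)[of "inverse t"]
        by (intro Bochner_Integration.integral_cong) auto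
      then show ?case by simp
    qed
    with conv[OF Htest] have "((\<lambda>t. g t * (\<integral>\<omega>. f (T' (inverse t) (\<zeta> \<omega>)) \<partial>P)) \<longlongrightarrow> (\<integral>x. H x \<partial>\<mu>)) at_top"
      by (rule Lim_transform_eventually)
    also have "(\<integral>x. H x \<partial>\<mu>) = (\<integral>x. indicator S x *\<^sub>R f (\<psi> x) \<partial>\<mu>)"
    proof (rule integral_cong_AE)
      show "H \<in> borel_measurable \<mu>"
        using continuous_map_borel_measurable[OF Hc] measurable_cong_sets[OF sets refl] by blast
      have "(\<lambda>x. f (\<psi> x)) \<in> borel_measurable (restrict_space \<mu> S)"
        using measurable_compose[OF \<psi>meas continuous_map_borel_measurable[OF fY]] .
      then show "(\<lambda>x. indicator S x *\<^sub>R f (\<psi> x)) \<in> borel_measurable \<mu>"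
        using S\<mu> by (subst (asm) borel_measurable_restrict_space_iff) (auto simp: space inf_absorb1 SX)
      show "AE x in \<mu>. H x = indicator S x *\<^sub>R f (\<psi> x)"
      proof (rule AE_mp[rotated], intro AE_I2 impI)
        show "AE x in \<mu>. \<phi> x \<noteq> 0 \<longrightarrow> x \<in> S" by (rule tail_measure_concentrated[OF lim S \<phi> A])
        fix x assume "\<phi> x \<noteq> 0 \<longrightarrow> x \<in> S"
        then show "H x = indicator S x *\<^sub>R f (\<psi> x)" using HS[of x] by (cases "x \<in> S") (auto simp: H_def)
      qed
    qed
    also have "\<dots> = (\<integral>x. f (\<psi> x) \<partial>restrict_space \<mu> S)"
      using S\<mu> SX by (intro integral_restrict_space[symmetric]) (auto simp: space inf_absorb1)
    also have "\<dots> = (\<integral>y. f y \<partial>distr (restrict_space \<mu> S) (borel_of Y) \<psi>)"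
      by (rule integral_distr[symmetric, OF \<psi>meas continuous_map_borel_measurable[OF fY]])
    also have "\<dots> = (\<integral>y. indicator (\<Union>J) y *\<^sub>R f y \<partial>distr (restrict_space \<mu> S) (borel_of Y) \<psi>)"
      using f0 by (intro Bochner_Integration.integral_cong) (auto simp: indicator_def)
    also have "\<dots> = (\<integral>y. f y \<partial>?\<nu>)"
      unfolding tail_pushforward_def using UJ continuous_map_borel_measurable[OF fY]
      by (subst integral_density[symmetric]) (auto simp: ennreal_indicator)
    finally show ?thesis .
  qed
  then show ?thesis
    unfolding tail_limit_def using Y P \<zeta>meas g sets\<nu> fin\<nu> null\<nu> by blast
qed

section \<open>Large support and many large atoms\<close>

lemma marked_idealI:
  fixes D :: "'a::euclidean_space measure set"
  assumes "D \<in> counting_ideal k" "B \<subseteq> D \<times> UNIV"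
  shows "B \<in> marked_ideal k"
  unfolding marked_ideal_def hull_def
proof (intro InterI, elim CollectE conjE)
  fix t :: "('a measure \<times> ennreal) set set" assume t: "ideal_on (topspace marked_topology) t"
    and sub: "{D \<times> UNIV |D. D \<in> counting_ideal k} \<subseteq> t"
  have "D \<times> UNIV \<in> t" using sub assms(1) by blast
  with t assms(2) show "B \<in> t" unfolding ideal_on_def by blast
qed

text \<open>
  The atoms accumulate only at the origin, so the points of \<open>\<psi>(m, r)\<close> outside the ball of radius \<open>c/2\<close>
  are atoms. At most \<open>k - 1\<close> of them would lie in a common subspace of dimension \<open>k - 1\<close>, bringing the
  whole set within \<open>c/2\<close> of it.
\<close>
lemma many_large_atoms:
  fixes m :: "'a::euclidean_space measure"
  assumes m: "m \<in> counting_measures" and c: "0 < c" and k: "1 \<le> k" "k - 1 \<le> DIM('a)"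
    and large: "ennreal c \<le> subspace_dist (k - 1) (support_map (m, r))"
  shows "of_nat k \<le> emeasure m {x. c/2 \<le> norm x}"
proof -
  let ?N = "{x \<in> atoms m. c/2 \<le> norm x}" and ?K = "support_map (m, r)"
  have c2: "0 < c/2" using c by simp
  have fin: "finite ?N" by (rule finite_atoms_outside_ball[OF m c2])
  have "?K \<subseteq> ?N \<union> cball 0 (c/2)"
    unfolding support_map_eq[OF m]
  proof (rule closure_minimal)
    show "closed (?N \<union> cball 0 (c/2))" by (intro closed_Un finite_imp_closed fin closed_cball)
  qed (use c in auto)
  then have sub: "{x \<in> ?K. c/2 < norm x} \<subseteq> ?N" by auto
  have "\<not> card ?N \<le> k - 1"
  proof
    assume "card ?N \<le> k - 1"
    then have "card {x \<in> ?K. c/2 < norm x} \<le> k - 1" using card_mono[OF fin sub] by linarith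
    then have "subspace_dist (k - 1) ?K \<le> ennreal (c/2)"
      by (intro subspace_dist_le_if_few_large_points compact_support_map[OF m] c2
          finite_subset[OF sub fin] k(2))
    with large have "ennreal c \<le> ennreal (c/2)" by simp
    then show False using c by simp
  qed
  then have "of_nat k \<le> (of_nat (card ?N) :: ennreal)" using k(1) by (intro of_nat_mono) linarith
  also have "\<dots> \<le> emeasure m {x. c/2 \<le> norm x}"
    using counting_measuresD(2)[OF m, of "{x. c/2 \<le> norm x}"] c
    by (intro card_atoms_le_emeasure[OF m fin]) auto
  finally show ?thesis .
qed

text \<open>
  The integral of a bump function over \<open>m\<close> lies between two counts, so that \<open>2(\<integral> u dm - k) + 1\<close>
  clamped to \<open>[0, 1]\<close> is \<open>1\<close> on measures with \<open>k\<close> atoms beyond radius \<open>s\<close>. Its support is contained in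
  \<open>\<integral> u dm \<ge> k - 1/2\<close>, where the integer count beyond \<open>s/2\<close> has to reach \<open>k\<close> as well.
\<close>
lemma counting_cutoff:
  assumes s: "0 < s"
  obtains \<phi> and A :: "('a::euclidean_space measure \<times> ennreal) set" where
    "continuous_map marked_topology euclideanreal \<phi>" "\<forall>q. 0 \<le> \<phi> q \<and> \<phi> q \<le> 1"
    "closedin marked_topology A" "A \<in> marked_ideal k" "\<forall>q. \<phi> q \<noteq> 0 \<longrightarrow> q \<in> A"
    "\<forall>m\<in>counting_measures. of_nat k \<le> emeasure m {x. s \<le> norm x} \<longrightarrow> (\<forall>r. \<phi> (m, r) = 1)"
proof -
  let ?X = "marked_topology :: ('a measure \<times> ennreal) topology"
  define u :: "'a \<Rightarrow> real" where "u = bump {x. s \<le> norm x} (s/2)"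
  obtain x0 :: 'a where "norm x0 = s" using vector_choose_size[of s] s by auto
  then have ne: "{x::'a. s \<le> norm x} \<noteq> {}" by auto
  have u: "u \<in> test_functions euclidean away_from_zero" "\<And>x. u x \<noteq> 0 \<Longrightarrow> s/2 \<le> norm x"
    unfolding u_def by (rule bump_test_function[OF ne, of _ "s/2"]; use s in auto)+
  have u01: "0 \<le> u x" "u x \<le> 1" for x
    using s by (auto simp: u_def intro!: bump_nonneg bump_le_1)
  have meas: "{x. t \<le> norm x} \<in> sets m" "emeasure m {x. t \<le> norm x} < \<infinity>"
    if "m \<in> counting_measures" "0 < t" for m :: "'a measure" and t
    using counting_measuresD(2,3)[OF that(1)] that(2) by auto
  define \<Phi> :: "'a measure \<times> ennreal \<Rightarrow> real" where "\<Phi> q = (\<integral>x. u x \<partial>fst q)" for q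
  have \<Phi>: "continuous_map ?X euclideanreal \<Phi>"
    unfolding \<Phi>_def
    using continuous_map_compose[OF continuous_map_fst[of vague_topology euclidean]
        continuous_map_integral_vague[OF u(1)]]
    by (simp add: o_def)
  define A where "A = {q \<in> topspace ?X. \<Phi> q \<in> {real k - 1/2..}}"
  define \<phi> where "\<phi> q = (if q \<in> topspace ?X then max 0 (min 1 (2 * (\<Phi> q - real k) + 1)) else 0)" for q
  have "continuous_map ?X euclideanreal (\<lambda>q. max 0 (min 1 (2 * (\<Phi> q - real k) + 1)))"
    using \<Phi> by (intro continuous_intros continuous_map_real_max continuous_map_real_min) auto
  then have cont: "continuous_map ?X euclideanreal \<phi>"
    by (rule continuous_map_eq) (simp add: \<phi>_def)
  have clA: "closedin ?X A"
    unfolding A_def by (rule closedin_continuous_map_preimage[OF \<Phi>]) simp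
  have many: "of_nat k \<le> emeasure m {x. s/2 \<le> norm x}"
    if m: "m \<in> counting_measures" and ge: "real k - 1/2 \<le> (\<integral>x. u x \<partial>m)" for m :: "'a measure"
  proof -
    let ?E = "{x::'a. s/2 \<le> norm x}"
    have E: "?E \<in> sets m" "emeasure m ?E < \<infinity>" using meas[OF m, of "s/2"] s by auto
    obtain n where n: "emeasure m ?E = ennreal_of_enat n"
      using m E(1) unfolding counting_measures_def by blast
    with E(2) obtain j where j: "emeasure m ?E = of_nat j" by (cases n) auto
    have "(\<integral>x. u x \<partial>m) \<le> (\<integral>x. indicator ?E x \<partial>m)"
    proof (rule integral_mono)
      show "integrable m u" by (rule integrable_test_function[OF m u(1)])
      show "integrable m (indicator ?E :: 'a \<Rightarrow> real)" using E by (intro integrable_real_indicator)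
      show "u x \<le> indicator ?E x" for x using u(2)[of x] u01[of x] by (auto simp: indicator_def)
    qed
    also have "\<dots> = real j" using E j by (simp add: measure_def)
    finally have "k \<le> j" using ge by linarith
    then show ?thesis unfolding j by (rule of_nat_mono)
  qed
  have "{m \<in> counting_measures. of_nat k \<le> emeasure m {x::'a. s/2 \<le> norm x}} \<in> counting_ideal k"
    using sets_outside_ball[of "s/2"] s
    by (auto simp: counting_ideal_def intro!: bexI[of _ "{x. s/2 \<le> norm x}"])
  then have "A \<in> marked_ideal k"
    by (rule marked_idealI) (use many in \<open>auto simp: A_def \<Phi>_def\<close>)
  moreover have "\<phi> q \<noteq> 0 \<Longrightarrow> q \<in> A" for q
    by (auto simp: \<phi>_def A_def max_def split: if_splits)
  moreover have "\<phi> (m, r) = 1"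
    if m: "m \<in> counting_measures" and ge: "of_nat k \<le> emeasure m {x. s \<le> norm x}" for m r
  proof -
    let ?E = "{x::'a. s \<le> norm x}"
    have E: "?E \<in> sets m" "emeasure m ?E < \<infinity>" using meas[OF m s] by auto
    have "ennreal (real k) \<le> ennreal (measure m ?E)"
      using ge E(2) by (simp add: emeasure_eq_ennreal_measure less_top ennreal_of_nat_eq_real_of_nat)
    then have "real k \<le> measure m ?E" by simp
    also have "\<dots> = (\<integral>x. indicator ?E x \<partial>m)" using E by simp
    also have "\<dots> \<le> (\<integral>x. u x \<partial>m)"
    proof (rule integral_mono)
      show "integrable m u" by (rule integrable_test_function[OF m u(1)])
      show "integrable m (indicator ?E :: 'a \<Rightarrow> real)" using E by (intro integrable_real_indicator)
      show "indicator ?E x \<le> u x" for x using bump_eq_1[of x ?E] u01[of x] by (auto simp: u_def indicator_def)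
    qed
    finally show ?thesis using m by (simp add: \<phi>_def \<Phi>_def)
  qed
  ultimately show ?thesis
    using that[of \<phi> A] cont clA by (auto simp: \<phi>_def)
qed

section \<open>The support of the point process\<close>

theorem theorem4p7p12:
  fixes P :: "'w measure"
    and \<eta> :: "'w \<Rightarrow> (real ^ 'd) measure"
    and g :: "real \<Rightarrow> real"
    and \<mu> :: "((real ^ 'd) measure \<times> ennreal) measure"
    and k :: nat
  assumes "2 \<le> k" and "k \<le> CARD('d)"
    and "prob_space P" and "\<eta> \<in> P \<rightarrow>\<^sub>M borel_of vague_topology"
    and "regularly_varying P marked_topology marked_scaling (marked_ideal k) g \<mu>
           (\<lambda>\<omega>. (\<eta> \<omega>, dist_zero (\<eta> \<omega>)))"
  defines "\<nu> \<equiv> tail_pushforward \<mu> support_domain support_map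
                 hausdorff_topology (subspace_ideal (k - 1))"
  shows "tail_limit P hausdorff_topology set_scaling (subspace_ideal (k - 1)) g \<nu>
           (\<lambda>\<omega>. closure (atoms (\<eta> \<omega>))) \<and>
         (nontrivial_on hausdorff_topology (subspace_ideal (k - 1)) \<nu> \<longrightarrow>
          regularly_varying P hausdorff_topology set_scaling (subspace_ideal (k - 1)) g \<nu>
           (\<lambda>\<omega>. closure (atoms (\<eta> \<omega>))))"
proof -
  have lim: "tail_limit P marked_topology marked_scaling (marked_ideal k) g \<mu>
      (\<lambda>\<omega>. (\<eta> \<omega>, dist_zero (\<eta> \<omega>)))"
    using assms(5) by (simp add: regularly_varying_def)
  have \<eta>: "\<eta> \<omega> \<in> counting_measures" if "\<omega> \<in> space P" for \<omega>
    using measurable_space[OF assms(4) that] by simp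
  \<comment> \<open>Regular variation of the marked process includes that scaling maps the marked space to itself.\<close>
  have scaled: "scale_measure_by t m \<in> counting_measures"
    if t: "0 < t" and m: "m \<in> counting_measures" for t and m :: "(real ^ 'd) measure"
  proof -
    have "continuous_map marked_topology marked_topology
        (marked_scaling t :: (real ^ 'd) measure \<times> ennreal \<Rightarrow> _)"
      using lim t by (simp add: tail_limit_def scaling_on_def)
    from continuous_map_funspace[OF this] have "marked_scaling t (m, 0) \<in> topspace marked_topology"
      using m by (auto simp: Pi_iff)
    then show ?thesis by (simp add: marked_scaling_def)
  qed
  have marked: "marked_scaling t (m, dist_zero m)
      = (scale_measure_by t m, dist_zero (scale_measure_by t m))"
    if "0 < t" "m \<in> counting_measures" for t and m :: "(real ^ 'd) measure"
    using dist_zero_scale_measure_by[OF that(2,1)] by (simp add: marked_scaling_def)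
  have "tail_limit P hausdorff_topology set_scaling (subspace_ideal (k - 1)) g \<nu>
      (\<lambda>\<omega>. closure (atoms (\<eta> \<omega>)))"
    unfolding \<nu>_def
  proof (rule tail_limit_pushforward[OF lim metrizable_hausdorff_topology scaling_on_set_scaling
        ideal_on_subspace_ideal openin_Union_subspace_ideal closedin_support_domain _
        continuous_map_support_map])
    fix t :: real and \<omega> assume t: "0 < t" and \<omega>: "\<omega> \<in> space P"
    note m = \<eta>[OF \<omega>] and sm = scaled[OF t \<eta>[OF \<omega>]]
    show "marked_scaling t (\<eta> \<omega>, dist_zero (\<eta> \<omega>)) \<in> support_domain"
      unfolding marked[OF t m] support_domain_iff using sm by simp
    show "support_map (marked_scaling t (\<eta> \<omega>, dist_zero (\<eta> \<omega>)))
        = set_scaling t (closure (atoms (\<eta> \<omega>)))"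
      unfolding marked[OF t m] support_map_dist_zero[OF sm] atoms_scale_measure_by[OF m t]
        set_scaling_def closure_scaleR ..
  next
    fix \<omega> assume "\<omega> \<in> space P"
    then show "closure (atoms (\<eta> \<omega>)) = support_map (\<eta> \<omega>, dist_zero (\<eta> \<omega>))"
      by (simp add: support_map_dist_zero \<eta>)
  next
    fix B :: "(real ^ 'd) set set" assume "B \<in> subspace_ideal (k - 1)"
    then obtain c where c: "0 < c" "\<forall>K\<in>B. ennreal c \<le> subspace_dist (k - 1) K"
      by (rule subspace_ideal_lower_bound)
    then have "0 < c/2" by simp
    then obtain \<phi> and A :: "((real ^ 'd) measure \<times> ennreal) set" where
      "continuous_map marked_topology euclideanreal \<phi>" "\<forall>q. 0 \<le> \<phi> q \<and> \<phi> q \<le> 1"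
      "closedin marked_topology A" "A \<in> marked_ideal k" "\<forall>q. \<phi> q \<noteq> 0 \<longrightarrow> q \<in> A"
      and one: "\<forall>m\<in>counting_measures. of_nat k \<le> emeasure m {x. c/2 \<le> norm x}
        \<longrightarrow> (\<forall>r. \<phi> (m, r) = 1)"
      by (rule counting_cutoff[where k = k])
    moreover have "\<phi> (m, r) = 1" if "(m, r) \<in> support_domain" "support_map (m, r) \<in> B" for m r
    proof -
      have m: "m \<in> counting_measures" using that by (simp add: support_domain_iff)
      have "of_nat k \<le> emeasure m {x. c/2 \<le> norm x}"
        by (rule many_large_atoms[OF m c(1)]) (use assms(1,2) c(2) that in auto)
      with one m show ?thesis by blast
    qed
    ultimately show "\<exists>\<phi> A. continuous_map marked_topology euclideanreal \<phi> \<and>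
        (\<forall>q. 0 \<le> \<phi> q \<and> \<phi> q \<le> 1) \<and> closedin marked_topology A \<and> A \<in> marked_ideal k \<and>
        (\<forall>q. \<phi> q \<noteq> 0 \<longrightarrow> q \<in> A) \<and> (\<forall>q\<in>support_domain. support_map q \<in> B \<longrightarrow> \<phi> q = 1)"
      by (intro exI[of _ \<phi>] exI[of _ A]) auto
  qed
  then show ?thesis by (simp add: regularly_varying_def)
qed

end
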